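(* Let $\underline{\lambda}=(\lambda_1\ge\cdots\ge\lambda_r\ge0)$ and $\underline{\mu}=(\mu_1\ge\cdots\ge\mu_r\ge0)$ be two sequences of integers, with $r\ge\max\{l(\underline{\lambda}),l(\underline{\mu})\}$. Write $$\Psi^r_{\underline{\lambda}}\otimes\Psi^r_{\underline{\mu}}=\sum_{\underline{\nu}}C_{\underline{\lambda}\,\underline{\mu}}^{\underline{\nu}}(r)\,\Psi^r_{\underline{\nu}},\qquad C_{\underline{\lambda}\,\underline{\mu}}^{\underline{\nu}}(r)\in\mathbb{Z}_{\ge0},$$ for the decomposition into irreducible representations of $\mathrm{GL}(r,\mathbb{C})$. If $r\ge l(\underline{\lambda})+l(\underline{\mu})$, then $$C_{\underline{\lambda}\,\underline{\mu}}^{\underline{\nu}}(r)=C_{\underline{\lambda}\,\underline{\mu}}^{\underline{\nu}}(r+1)$$ for all sequences of integers $\underline{\nu}=(\nu_1\ge\nu_2\ge\cdots\ge\nu_r\ge 0)$.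
   Context: For a sequence of integers $\underline{\lambda}=(\lambda_1\ge\lambda_2\ge\cdots\ge0)$ the length $l(\underline{\lambda})$ is the largest $s$ with $\lambda_s\ne0$ (and $0$ if all entries vanish). For $r\ge l(\underline{\lambda})$, $\Psi^r_{\underline{\lambda}}$ denotes the irreducible representation of $\mathrm{GL}(r,\mathbb{C})$ with highest weight $(\lambda_1,\dots,\lambda_r)$, where trailing zeros are added or dropped as needed; in particular $\underline{\nu}=(\nu_1,\dots,\nu_r)$ is regarded as $(\nu_1,\dots,\nu_r,0)$ when considered for $\mathrm{GL}(r+1,\mathbb{C})$, and $C_{\underline{\lambda}\,\underline{\mu}}^{\underline{\nu}}(r+1)$ is the corresponding multiplicity for the group $\mathrm{GL}(r+1,\mathbb{C})$. *)

theory Defs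
  imports "Jordan_Normal_Form.Determinant" "Jordan_Normal_Form.VS_Connect"
begin

text \<open>
  Sequences of integers are functions \<^typ>\<open>nat \<Rightarrow> int\<close>, and the entry with mathematical index
  \<open>s\<close> is the value at \<open>s - 1\<close>. Sequences of different lengths are padded with zeros, so one
  function serves as a weight of all the groups \<open>GL(r)\<close> with \<open>r\<close> at least its length.
\<close>

definition nonneg_decreasing_seq :: "(nat \<Rightarrow> int) \<Rightarrow> bool" where
  "nonneg_decreasing_seq w \<longleftrightarrow>
     (\<forall>i j. i \<le> j \<longrightarrow> w j \<le> w i) \<and> (\<forall>i. 0 \<le> w i) \<and> finite {i. w i \<noteq> 0}"

definition seq_length :: "(nat \<Rightarrow> int) \<Rightarrow> nat" where
  "seq_length w = Max (insert 0 {s. s \<ge> 1 \<and> w (s - 1) \<noteq> 0})"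

text \<open>Dominant integral weights of \<open>GL(r)\<close>. Negative entries are allowed; the entries past the
  first \<open>r\<close> are fixed to zero so that each weight is represented by exactly one function.\<close>

definition dominant_weight :: "nat \<Rightarrow> (nat \<Rightarrow> int) \<Rightarrow> bool" where
  "dominant_weight r w \<longleftrightarrow>
     (\<forall>i j. i \<le> j \<and> j < r \<longrightarrow> w j \<le> w i) \<and> (\<forall>i\<ge>r. w i = 0)"

definition GL :: "nat \<Rightarrow> complex mat monoid" where
  "GL r = units_of (ring_mat TYPE(complex) r ())"

text \<open>The coordinate ring of \<open>GL(r)\<close>: polynomials in the matrix entries and the inverse of the
  determinant.\<close>

inductive regular_fun :: "nat \<Rightarrow> (complex mat \<Rightarrow> complex) \<Rightarrow> bool" for r where
  const: "regular_fun r (\<lambda>A. c)"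
| entry: "i < r \<Longrightarrow> j < r \<Longrightarrow> regular_fun r (\<lambda>A. A $$ (i, j))"
| inverse_det: "regular_fun r (\<lambda>A. inverse (det A))"
| add: "regular_fun r f \<Longrightarrow> regular_fun r g \<Longrightarrow> regular_fun r (\<lambda>A. f A + g A)"
| mult: "regular_fun r f \<Longrightarrow> regular_fun r g \<Longrightarrow> regular_fun r (\<lambda>A. f A * g A)"

text \<open>A (rational) representation of \<open>GL(r)\<close> on the complex vector space of column vectors of
  dimension \<open>n\<close>. Only the values of \<open>\<rho>\<close> on \<open>carrier (GL r)\<close> matter.\<close>

definition representation :: "nat \<Rightarrow> nat \<Rightarrow> (complex mat \<Rightarrow> complex mat) \<Rightarrow> bool" where
  "representation r n \<rho> \<longleftrightarrow>
     \<rho> \<in> hom (GL r) (GL n) \<and>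
     (\<forall>i<n. \<forall>j<n. \<exists>f. regular_fun r f \<and> (\<forall>g\<in>carrier (GL r). \<rho> g $$ (i, j) = f g))"

definition irreducible_representation ::
    "nat \<Rightarrow> nat \<Rightarrow> (complex mat \<Rightarrow> complex mat) \<Rightarrow> bool" where
  "irreducible_representation r n \<rho> \<longleftrightarrow>
     representation r n \<rho> \<and> n > 0 \<and>
     (\<forall>W. VectorSpace.subspace class_ring W (module_vec TYPE(complex) n) \<and>
          (\<forall>g\<in>carrier (GL r). \<forall>w\<in>W. \<rho> g *\<^sub>v w \<in> W) \<longrightarrow>
          W = {0\<^sub>v n} \<or> W = carrier_vec n)"

text \<open>A highest weight vector is an eigenvector of the Borel subgroup of upper triangular matrices:
  it is fixed by the unipotent ones, and the diagonal ones act on it by the weight.\<close>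

definition highest_weight_vector ::
    "nat \<Rightarrow> (nat \<Rightarrow> int) \<Rightarrow> nat \<Rightarrow> (complex mat \<Rightarrow> complex mat) \<Rightarrow> complex vec \<Rightarrow> bool" where
  "highest_weight_vector r w n \<rho> v \<longleftrightarrow>
     v \<in> carrier_vec n \<and> v \<noteq> 0\<^sub>v n \<and>
     (\<forall>b\<in>carrier (GL r). upper_triangular b \<longrightarrow>
        \<rho> b *\<^sub>v v = (\<Prod>i<r. (b $$ (i, i)) powi (w i)) \<cdot>\<^sub>v v)"

text \<open>\<open>is_Psi r w n \<rho>\<close>: the representation \<open>\<rho>\<close>, of dimension \<open>n\<close>, is a model of the irreducible
  representation of \<open>GL(r)\<close> with highest weight \<open>w\<close>, which is only defined up to isomorphism.\<close>

definition is_Psi ::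
    "nat \<Rightarrow> (nat \<Rightarrow> int) \<Rightarrow> nat \<Rightarrow> (complex mat \<Rightarrow> complex mat) \<Rightarrow> bool" where
  "is_Psi r w n \<rho> \<longleftrightarrow>
     irreducible_representation r n \<rho> \<and> (\<exists>v. highest_weight_vector r w n \<rho> v)"

definition isomorphic_reps ::
    "nat \<Rightarrow> nat \<Rightarrow> (complex mat \<Rightarrow> complex mat) \<Rightarrow> nat \<Rightarrow> (complex mat \<Rightarrow> complex mat) \<Rightarrow> bool" where
  "isomorphic_reps r n \<rho> m \<sigma> \<longleftrightarrow>
     n = m \<and> (\<exists>P\<in>carrier (GL n). \<forall>g\<in>carrier (GL r). P * \<rho> g = \<sigma> g * P)"

text \<open>Kronecker product, the matrix of the tensor product of two linear maps in the
  lexicographically ordered tensor basis.\<close>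

definition kronecker :: "complex mat \<Rightarrow> complex mat \<Rightarrow> complex mat" where
  "kronecker A B =
     mat (dim_row A * dim_row B) (dim_col A * dim_col B)
       (\<lambda>(i, j). A $$ (i div dim_row B, j div dim_col B) * B $$ (i mod dim_row B, j mod dim_col B))"

text \<open>\<open>tensor_decomposition r lam mu C\<close>: the tensor product of the irreducible representations of
  \<open>GL(r)\<close> with highest weights \<open>lam\<close> and \<open>mu\<close> is isomorphic to the direct sum, over dominant
  weights \<open>\<nu>\<close>, of \<open>C \<nu>\<close> copies of the irreducible representation with highest weight \<open>\<nu>\<close>.
  The list \<open>\<nu>s\<close> contains the highest weights of the summands with repetition.\<close>

definition tensor_decomposition ::
    "nat \<Rightarrow> (nat \<Rightarrow> int) \<Rightarrow> (nat \<Rightarrow> int) \<Rightarrow> ((nat \<Rightarrow> int) \<Rightarrow> nat) \<Rightarrow> bool" where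
  "tensor_decomposition r lam mu C \<longleftrightarrow>
     (\<exists>n \<rho> m \<sigma> d \<psi> \<nu>s.
        is_Psi r lam n \<rho> \<and> is_Psi r mu m \<sigma> \<and>
        (\<forall>\<nu>\<in>set \<nu>s. dominant_weight r \<nu> \<and> is_Psi r \<nu> (d \<nu>) (\<psi> \<nu>)) \<and>
        isomorphic_reps r
          (n * m) (\<lambda>g. kronecker (\<rho> g) (\<sigma> g))
          (\<Sum>\<nu>\<leftarrow>\<nu>s. d \<nu>) (\<lambda>g. diag_block_mat (map (\<lambda>\<nu>. \<psi> \<nu> g) \<nu>s)) \<and>
        (\<forall>\<nu>. C \<nu> = count_list \<nu>s \<nu>))"

end

theory Submission
  imports Defs "Jordan_Normal_Form.Char_Poly"
begin

text \<open>
  Let \<open>V\<close> be the irreducible representation of \<open>GL(r+1)\<close> with highest weight \<open>w\<close>. Since the big cell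
  is dense, \<open>V\<close> is spanned by the images of the highest weight vector under the lower triangular
  group, so \<open>w\<^sub>r\<^sub>+\<^sub>1\<close> is the lowest exponent of \<open>t\<close> in the action of \<open>diag(1,\<dots>,1,t)\<close>. Hence
  \<open>t\<close> to the power \<open>-w\<^sub>r\<^sub>+\<^sub>1\<close> times that action converges, as \<open>t\<close> tends to \<open>0\<close>, to the projection onto
  the lowest weight space, and this space is the irreducible representation of \<open>GL(r)\<close> with highest
  weight \<open>(w\<^sub>1,\<dots>,w\<^sub>r)\<close>. On characters the operation is the leading coefficient in \<open>t\<close>. Induction on
  \<open>r\<close> along it shows that the highest weight determines the character and that irreducible
  characters are linearly independent. Letting \<open>t\<close> tend to \<open>0\<close> in the character identity of the tensor
  product for \<open>GL(r+1)\<close> keeps the summands with \<open>\<nu>\<^sub>r\<^sub>+\<^sub>1 = 0\<close> and yields the identity for \<open>GL(r)\<close>, so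
  the multiplicities agree.
\<close>

section \<open>Matrices and subspaces\<close>

text \<open>Limits take the place of complete reducibility and weight space decompositions. Density
  is used in the one-parameter form \<open>g + t 1\<close> with \<open>t\<close> tending to
  \<open>0\<close>: the exceptional \<open>t\<close> are roots of two characteristic polynomials, so
  continuity of matrix entries does the work of Zariski density. The engine is the factorisation of
  a big cell element into lower unipotent, Levi and upper unipotent parts. Compressed to the limit
  projection \<open>P\<close>, both unipotent factors disappear and only the Levi factor survives,
  up to the scalar \<open>d powi (w r)\<close>. This one identity gives irreducibility of the
  truncated representation and a recursion in the rank for matrix coefficients at a highest weight
  vector. Agreement of these coefficients yields an intertwiner, hence equal characters. Summands
  for \<open>GL(r+1)\<close> could a priori have a negative last entry, which would spoil the limit.
  The most singular terms are excluded by evaluation at the identity matrix, where they form a sum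
  of positive multiples of dimensions and cannot cancel.\<close>

lemma mult_mat_assoc:
  fixes A :: "'a :: semiring_0 mat"
  assumes "dim_col A = dim_row B" "dim_col B = dim_row C"
  shows "A * B * C = A * (B * C)"
  using assms by (intro assoc_mult_mat) auto

lemma mult_mat_vec_assoc:
  fixes A :: "'a :: comm_semiring_0 mat"
  assumes "dim_col A = dim_row B" "dim_col B = dim_vec v"
  shows "A * B *\<^sub>v v = A *\<^sub>v (B *\<^sub>v v)"
  using assms by (intro assoc_mult_mat_vec) auto

lemmas mat_assoc = mult_mat_assoc mult_mat_vec_assoc

lemma smult_mult_mat_vec:
  fixes A :: "'a :: comm_semiring_0 mat"
  assumes "dim_col A = dim_vec v"
  shows "(c \<cdot>\<^sub>m A) *\<^sub>v v = c \<cdot>\<^sub>v (A *\<^sub>v v)"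
  using assms by (intro eq_vecI) auto

lemma eq_mat_by_mult_vec:
  fixes A :: "'a :: comm_semiring_1 mat"
  assumes "A \<in> carrier_mat n m" "B \<in> carrier_mat n m"
    and "\<And>x. x \<in> carrier_vec m \<Longrightarrow> A *\<^sub>v x = B *\<^sub>v x"
  shows "A = B"
proof (rule eq_matI)
  fix i j assume "i < dim_row B" "j < dim_col B"
  then have ij: "i < n" "j < m" using assms by auto
  have "(A *\<^sub>v unit_vec m j) $ i = (B *\<^sub>v unit_vec m j) $ i"
    using assms(3)[of "unit_vec m j"] by simp
  then show "A $$ (i,j) = B $$ (i,j)"
    using ij assms(1,2) by (simp add: scalar_prod_right_unit)
qed (use assms in auto)

lemma scalar_prod_smult_vec:
  fixes x y :: "'a :: comm_semiring_0 vec"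
  shows "x \<bullet> (c \<cdot>\<^sub>v y) = c * (x \<bullet> y)"
  by (simp add: scalar_prod_def sum_distrib_left ac_simps)

lemma scalar_prod_add_vec:
  fixes x y z :: "'a :: comm_semiring_0 vec"
  assumes "dim_vec y = dim_vec z"
  shows "x \<bullet> (y + z) = x \<bullet> y + x \<bullet> z"
  using assms by (simp add: scalar_prod_def sum.distrib algebra_simps)

definition lin_subspace :: "nat \<Rightarrow> complex vec set \<Rightarrow> bool" where
  "lin_subspace n W \<longleftrightarrow> W \<subseteq> carrier_vec n \<and> 0\<^sub>v n \<in> W \<and>
     (\<forall>x\<in>W. \<forall>y\<in>W. x + y \<in> W) \<and> (\<forall>c. \<forall>x\<in>W. c \<cdot>\<^sub>v x \<in> W)"

lemma subspace_module_vec_iff: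
  "VectorSpace.subspace class_ring W (module_vec TYPE(complex) n) \<longleftrightarrow> lin_subspace n W"
proof -
  interpret vec_space "TYPE(complex)" n .
  have m: "Module.module class_ring V" by unfold_locales
  have v: "vectorspace class_ring V" by unfold_locales
  show ?thesis
    unfolding VectorSpace.subspace_def submodule_def lin_subspace_def
    using m v by (auto simp: module_vec_simps)
qed

section \<open>Splittings\<close>

text \<open>Padding both factors with zeros to size \<open>m\<close> turns the one-sided inverse
  into a two-sided one; for \<open>n < m\<close> this contradicts the zero row \<open>n\<close> of
  \<open>S'\<close>.\<close>

lemma left_inverse_dim_le:
  fixes R S :: "'a :: field mat"
  assumes R: "R \<in> carrier_mat m n" and S: "S \<in> carrier_mat n m" and RS: "R * S = 1\<^sub>m m"
  shows "m \<le> n"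
proof (rule ccontr)
  assume "\<not> m \<le> n"
  define R' where "R' = mat m m (\<lambda>(i,j). if j < n then R $$ (i,j) else 0)"
  define S' where "S' = mat m m (\<lambda>(i,j). if i < n then S $$ (i,j) else 0)"
  have "R' * S' = R * S"
  proof (rule eq_matI)
    fix i j assume "i < dim_row (R * S)" "j < dim_col (R * S)"
    then have ij: "i < m" "j < m" using R S by auto
    have "(R' * S') $$ (i,j) = (\<Sum>k<m. (if k < n then R $$ (i,k) * S $$ (k,j) else 0))"
      using ij by (auto simp: R'_def S'_def scalar_prod_def lessThan_atLeast0 intro!: sum.cong)
    also have "\<dots> = (\<Sum>k<n. R $$ (i,k) * S $$ (k,j))"
      using \<open>\<not> m \<le> n\<close> by (intro sum.mono_neutral_cong_right) auto
    finally show "(R' * S') $$ (i,j) = (R * S) $$ (i,j)"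
      using ij R S by (simp add: scalar_prod_def lessThan_atLeast0)
  qed (use R S in \<open>auto simp: R'_def S'_def\<close>)
  then have "R' * S' = 1\<^sub>m m" using RS by simp
  then have "S' * R' = 1\<^sub>m m"
    by (rule mat_mult_left_right_inverse[rotated 2]) (auto simp: R'_def S'_def)
  moreover have "(S' * R') $$ (n,n) = 0"
    using \<open>\<not> m \<le> n\<close> by (auto simp: R'_def S'_def scalar_prod_def)
  ultimately show False using \<open>\<not> m \<le> n\<close> by simp
qed

text \<open>Coordinates on a subspace: \<open>S\<close> parametrises \<open>W\<close> and
  \<open>S * R\<close> projects onto it. A partial splitting with the largest possible
  \<open>m\<close> works, since a vector of \<open>W\<close> that \<open>S * R\<close> moves would
  supply one more coordinate.\<close>

lemma lin_subspace_split:
  assumes W: "lin_subspace n W"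
  obtains m R S where "R \<in> carrier_mat m n" "S \<in> carrier_mat n m" "R * S = 1\<^sub>m m"
    "W = {x \<in> carrier_vec n. S *\<^sub>v (R *\<^sub>v x) = x}"
proof -
  define good where "good m \<longleftrightarrow> (\<exists>R S. R \<in> carrier_mat m n \<and> S \<in> carrier_mat n m \<and>
     R * S = 1\<^sub>m m \<and> (\<forall>y\<in>carrier_vec m. S *\<^sub>v y \<in> W))" for m
  have "good 0"
  proof -
    have "0\<^sub>m n 0 *\<^sub>v y \<in> W" if "y \<in> carrier_vec 0" for y
    proof -
      have "0\<^sub>m n 0 *\<^sub>v y = 0\<^sub>v n" using that by (intro eq_vecI) (auto simp: scalar_prod_def)
      then show ?thesis using W by (auto simp: lin_subspace_def)
    qed
    moreover have "0\<^sub>m 0 n * 0\<^sub>m n 0 = (1\<^sub>m 0 :: complex mat)" by (intro eq_matI) auto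
    ultimately show ?thesis unfolding good_def by (metis zero_carrier_mat)
  qed
  moreover have le: "m \<le> n" if "good m" for m
    using that left_inverse_dim_le by (auto simp: good_def)
  ultimately obtain m where m: "good m" and max: "\<And>k. good k \<Longrightarrow> k \<le> m"
    using Nat.ex_has_greatest_nat[of good 0 n] by blast
  from m obtain R S where R: "R \<in> carrier_mat m n" and S: "S \<in> carrier_mat n m"
    and RS: "R * S = 1\<^sub>m m" and SW: "\<And>y. y \<in> carrier_vec m \<Longrightarrow> S *\<^sub>v y \<in> W"
    by (auto simp: good_def)
  note [simp] = carrier_matD[OF R] carrier_matD[OF S]
  have "S *\<^sub>v (R *\<^sub>v w) = w" if w: "w \<in> W" for w
  proof (rule ccontr)
    assume ne: "S *\<^sub>v (R *\<^sub>v w) \<noteq> w"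
    have wc: "w \<in> carrier_vec n" using w W by (auto simp: lin_subspace_def)
    then have [simp]: "dim_vec w = n" by auto
    \<comment> \<open>The component of \<open>w\<close> that \<open>S * R\<close> misses; it lies in
      \<open>W\<close> and is killed by \<open>R\<close>.\<close>
    define u where "u = w + (-1) \<cdot>\<^sub>v (S *\<^sub>v (R *\<^sub>v w))"
    have uW: "u \<in> W"
      using W w SW[of "R *\<^sub>v w"] R wc unfolding u_def lin_subspace_def by auto
    have u: "u \<in> carrier_vec n" using uW W by (auto simp: lin_subspace_def)
    have "R *\<^sub>v u = R *\<^sub>v w + (-1) \<cdot>\<^sub>v ((R * S) *\<^sub>v (R *\<^sub>v w))"
      unfolding u_def using R S wc
      by (simp add: mult_add_distrib_mat_vec[of _ m n] mult_mat_vec[of _ m n] mat_assoc)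
    also note RS
    also have "1\<^sub>m m *\<^sub>v (R *\<^sub>v w) = R *\<^sub>v w" using R wc by simp
    finally have "R *\<^sub>v u = R *\<^sub>v w + (-1) \<cdot>\<^sub>v (R *\<^sub>v w)" .
    moreover have "x + (-1) \<cdot>\<^sub>v x = 0\<^sub>v m" if "x \<in> carrier_vec m" for x :: "complex vec"
      using that by (intro eq_vecI) auto
    moreover have "R *\<^sub>v w \<in> carrier_vec m" using R wc by simp
    ultimately have Ru: "R *\<^sub>v u = 0\<^sub>v m" by metis
    have "\<exists>i<n. u $ i \<noteq> 0"
    proof (rule ccontr)
      assume "\<not> (\<exists>i<n. u $ i \<noteq> 0)"
      then have "S *\<^sub>v (R *\<^sub>v w) = w" by (intro eq_vecI) (auto simp: u_def)
      with ne show False by simp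
    qed
    then obtain i where i: "i < n" "u $ i \<noteq> 0" by blast
    \<comment> \<open>The rows of \<open>1 - S * R\<close> vanish on the image of \<open>S\<close>,
      and row \<open>i\<close> takes the value \<open>u $ i\<close> at \<open>u\<close> because
      \<open>R\<close> kills \<open>u\<close>. After scaling, \<open>q\<close> is the coordinate
      dual to \<open>u\<close>.\<close>
    define q where "q = (1 / u $ i) \<cdot>\<^sub>v (row (1\<^sub>m n - S * R) i)"
    have q: "q \<in> carrier_vec n" by (intro carrier_vecI) (simp add: q_def)
    define R' where "R' = mat (Suc m) n (\<lambda>(a,b). if a < m then R $$ (a,b) else q $ b)"
    define S' where "S' = mat n (Suc m) (\<lambda>(a,b). if b < m then S $$ (a,b) else u $ a)"
    have row: "row R' a = (if a < m then row R a else q)" if "a < Suc m" for a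
      using that q R by (auto simp: R'_def intro!: eq_vecI)
    have col: "col S' b = (if b < m then col S b else u)" if "b < Suc m" for b
      using that u S by (auto simp: S'_def intro!: eq_vecI)
    have qS: "q \<bullet> col S b = 0" if "b < m" for b
    proof -
      have "(1\<^sub>m n - S * R) * S = S - S * (R * S)"
        using R S by (simp add: minus_mult_distrib_mat[of _ n n] mat_assoc)
      also have "\<dots> = 0\<^sub>m n m" using RS S by auto
      finally have "((1\<^sub>m n - S * R) * S) $$ (i,b) = 0" using i that by simp
      then show ?thesis using i that S R by (simp add: q_def)
    qed
    have qu: "q \<bullet> u = 1"
    proof -
      have "(1\<^sub>m n - S * R) *\<^sub>v u = u - S *\<^sub>v (R *\<^sub>v u)"
        using u R S by (simp add: minus_mult_distrib_mat_vec[of _ n n] mat_assoc)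
      also have "S *\<^sub>v (R *\<^sub>v u) = 0\<^sub>v n" unfolding Ru by (intro eq_vecI) (auto simp: scalar_prod_def)
      also have "u - 0\<^sub>v n = u" using u by simp
      finally have "((1\<^sub>m n - S * R) *\<^sub>v u) $ i = u $ i" by simp
      then show ?thesis using i u by (simp add: q_def)
    qed
    have "R' * S' = 1\<^sub>m (Suc m)"
    proof (rule eq_matI)
      fix a b assume "a < dim_row (1\<^sub>m (Suc m))" "b < dim_col (1\<^sub>m (Suc m))"
      then have ab: "a < Suc m" "b < Suc m" by auto
      have 1: "(R' * S') $$ (a,b) = row R' a \<bullet> col S' b"
        using ab by (simp add: R'_def S'_def)
      have 2: "row R a \<bullet> col S b = (if a = b then 1 else 0)" if "a < m" "b < m"
        using arg_cong[OF RS, of "\<lambda>A. A $$ (a,b)"] that by simp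
      have 3: "row R a \<bullet> u = 0" if "a < m"
        using arg_cong[OF Ru, of "\<lambda>x. x $ a"] that by simp
      show "(R' * S') $$ (a,b) = 1\<^sub>m (Suc m) $$ (a,b)"
        unfolding 1 row[OF ab(1)] col[OF ab(2)] using ab 2 3 qS qu by auto
    qed (auto simp: R'_def S'_def)
    moreover have "S' *\<^sub>v y \<in> W" if y: "y \<in> carrier_vec (Suc m)" for y
    proof -
      have "S' *\<^sub>v y = S *\<^sub>v vec m (\<lambda>i. y $ i) + y $ m \<cdot>\<^sub>v u"
      proof (rule eq_vecI)
        fix a assume "a < dim_vec (S *\<^sub>v vec m (\<lambda>i. y $ i) + y $ m \<cdot>\<^sub>v u)"
        then have a: "a < n" using u by auto
        have "(S' *\<^sub>v y) $ a = (\<Sum>b<Suc m. S' $$ (a,b) * y $ b)"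
          using a y by (auto simp: S'_def scalar_prod_def lessThan_atLeast0 intro!: sum.cong)
        also have "\<dots> = (\<Sum>b<m. S $$ (a,b) * y $ b) + u $ a * y $ m"
          using a by (auto simp: S'_def)
        finally show "(S' *\<^sub>v y) $ a = (S *\<^sub>v vec m (\<lambda>i. y $ i) + y $ m \<cdot>\<^sub>v u) $ a"
          using a u by (simp add: scalar_prod_def lessThan_atLeast0)
      qed (use u in \<open>auto simp: S'_def\<close>)
      then show ?thesis
        using SW[of "vec m (\<lambda>i. y $ i)"] uW W by (auto simp: lin_subspace_def)
    qed
    ultimately have "good (Suc m)"
      unfolding good_def by (intro exI[of _ R'] exI[of _ S']) (auto simp: R'_def S'_def)
    then show False using max by fastforce
  qed
  moreover have "x \<in> W" if "x \<in> carrier_vec n" "S *\<^sub>v (R *\<^sub>v x) = x" for x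
    using SW[of "R *\<^sub>v x"] that R by simp
  ultimately have "W = {x \<in> carrier_vec n. S *\<^sub>v (R *\<^sub>v x) = x}"
    using W by (auto simp: lin_subspace_def)
  then show thesis using that R S RS by blast
qed

section \<open>Limits of matrices\<close>

text \<open>The size is demanded only eventually, because \<open>\<rho> (A t)\<close> is controlled
  only where \<open>A t\<close> is invertible.\<close>

definition mat_lim ::
    "nat \<Rightarrow> nat \<Rightarrow> ('a \<Rightarrow> 'b :: {topological_space,zero} mat) \<Rightarrow> 'b mat \<Rightarrow> 'a filter \<Rightarrow> bool" where
  "mat_lim n m A L F \<longleftrightarrow> L \<in> carrier_mat n m \<and> (\<forall>\<^sub>F t in F. A t \<in> carrier_mat n m) \<and>
     (\<forall>i<n. \<forall>j<m. ((\<lambda>t. A t $$ (i,j)) \<longlongrightarrow> L $$ (i,j)) F)"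

lemma mat_limD:
  assumes "mat_lim n m A L F"
  shows "L \<in> carrier_mat n m" "\<forall>\<^sub>F t in F. A t \<in> carrier_mat n m"
    "i < n \<Longrightarrow> j < m \<Longrightarrow> ((\<lambda>t. A t $$ (i,j)) \<longlongrightarrow> L $$ (i,j)) F"
  using assms by (auto simp: mat_lim_def)

lemma mat_lim_const: "L \<in> carrier_mat n m \<Longrightarrow> mat_lim n m (\<lambda>_. L) L F"
  by (auto simp: mat_lim_def)

lemma mat_lim_cong:
  assumes "mat_lim n m A L F" and ev: "\<forall>\<^sub>F t in F. A t = B t"
  shows "mat_lim n m B L F"
proof -
  have "\<forall>\<^sub>F t in F. B t \<in> carrier_mat n m"
    using mat_limD(2)[OF assms(1)] ev by eventually_elim simp
  moreover have "((\<lambda>t. B t $$ (i,j)) \<longlongrightarrow> L $$ (i,j)) F" if "i < n" "j < m" for i j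
    using mat_limD(3)[OF assms(1) that]
    by (rule Lim_transform_eventually) (use ev in eventually_elim, simp)
  ultimately show ?thesis using mat_limD(1)[OF assms(1)] by (auto simp: mat_lim_def)
qed

lemma mat_lim_unique:
  fixes A :: "'a \<Rightarrow> 'b :: {t2_space,zero} mat"
  assumes "mat_lim n m A L F" "mat_lim n m A M F" "F \<noteq> bot"
  shows "L = M"
proof (rule eq_matI)
  fix i j assume "i < dim_row M" "j < dim_col M"
  then have "i < n" "j < m" using mat_limD(1)[OF assms(2)] by auto
  then show "L $$ (i,j) = M $$ (i,j)"
    using mat_limD(3)[OF assms(1)] mat_limD(3)[OF assms(2)] assms(3) tendsto_unique by blast
qed (use mat_limD(1)[OF assms(1)] mat_limD(1)[OF assms(2)] in auto)

lemma mat_lim_compose: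
  assumes A: "mat_lim n m A L G" and f: "filterlim f G F"
  shows "mat_lim n m (\<lambda>t. A (f t)) L F"
  using mat_limD(1)[OF A] filterlim_compose[OF mat_limD(3)[OF A] f]
    eventually_compose_filterlim[OF mat_limD(2)[OF A] f] by (simp add: mat_lim_def)

lemma eventually_at_0I:
  fixes P :: "complex \<Rightarrow> bool"
  assumes "\<And>t. t \<noteq> 0 \<Longrightarrow> P t" shows "\<forall>\<^sub>F t in at 0. P t"
  using assms by (simp add: eventually_at_filter)

lemma filterlim_mult_at_0:
  fixes s :: complex
  assumes "s \<noteq> 0"
  shows "filterlim (\<lambda>t. s * t) (at 0) (at 0)"
proof -
  have "((\<lambda>t. s * t) \<longlongrightarrow> s * 0) (at 0)" by (intro tendsto_intros)
  moreover have "\<forall>\<^sub>F t in at 0. s * t \<noteq> 0"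
    using assms by (intro eventually_at_0I) simp
  ultimately show ?thesis by (simp add: filterlim_at)
qed

lemma mat_lim_mult:
  fixes A B :: "'a \<Rightarrow> complex mat"
  assumes A: "mat_lim n k A L F" and B: "mat_lim k m B M F"
  shows "mat_lim n m (\<lambda>t. A t * B t) (L * M) F"
proof -
  have ev: "\<forall>\<^sub>F t in F. A t \<in> carrier_mat n k \<and> B t \<in> carrier_mat k m"
    using mat_limD(2)[OF A] mat_limD(2)[OF B] by eventually_elim simp
  have "((\<lambda>t. (A t * B t) $$ (i,j)) \<longlongrightarrow> (L * M) $$ (i,j)) F" if ij: "i < n" "j < m" for i j
  proof -
    have entry: "(X * Y) $$ (i,j) = (\<Sum>l<k. X $$ (i,l) * Y $$ (l,j))"
      if "X \<in> carrier_mat n k \<and> Y \<in> carrier_mat k m" for X Y :: "complex mat"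
      using that ij by (auto simp: scalar_prod_def lessThan_atLeast0)
    have "((\<lambda>t. \<Sum>l<k. A t $$ (i,l) * B t $$ (l,j)) \<longlongrightarrow> (\<Sum>l<k. L $$ (i,l) * M $$ (l,j))) F"
      using ij by (intro tendsto_intros mat_limD(3)[OF A] mat_limD(3)[OF B]) auto
    then have "((\<lambda>t. \<Sum>l<k. A t $$ (i,l) * B t $$ (l,j)) \<longlongrightarrow> (L * M) $$ (i,j)) F"
      using entry mat_limD(1)[OF A] mat_limD(1)[OF B] by simp
    then show ?thesis
      by (rule Lim_transform_eventually) (use ev entry in \<open>auto elim!: eventually_mono\<close>)
  qed
  moreover have "\<forall>\<^sub>F t in F. A t * B t \<in> carrier_mat n m"
    using ev by eventually_elim auto
  ultimately show ?thesis
    using mat_limD(1)[OF A] mat_limD(1)[OF B] by (auto simp: mat_lim_def)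
qed

lemma mat_lim_scalar_prod:
  fixes A :: "'a \<Rightarrow> complex mat"
  assumes A: "mat_lim n m A L F" and x: "x \<in> carrier_vec n" and y: "y \<in> carrier_vec m"
  shows "((\<lambda>t. x \<bullet> (A t *\<^sub>v y)) \<longlongrightarrow> x \<bullet> (L *\<^sub>v y)) F"
proof -
  have entry: "x \<bullet> (X *\<^sub>v y) = (\<Sum>i<n. x $ i * (\<Sum>j<m. X $$ (i,j) * y $ j))"
    if "X \<in> carrier_mat n m" for X :: "complex mat"
    using that x y by (auto simp: scalar_prod_def lessThan_atLeast0 intro!: sum.cong)
  have "((\<lambda>t. \<Sum>i<n. x $ i * (\<Sum>j<m. A t $$ (i,j) * y $ j)) \<longlongrightarrow>
      (\<Sum>i<n. x $ i * (\<Sum>j<m. L $$ (i,j) * y $ j))) F"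
    by (intro tendsto_intros mat_limD(3)[OF A]) auto
  then have "((\<lambda>t. \<Sum>i<n. x $ i * (\<Sum>j<m. A t $$ (i,j) * y $ j)) \<longlongrightarrow> x \<bullet> (L *\<^sub>v y)) F"
    using entry mat_limD(1)[OF A] by simp
  then show ?thesis
    by (rule Lim_transform_eventually)
      (use mat_limD(2)[OF A] entry in \<open>auto elim!: eventually_mono\<close>)
qed

lemma mat_lim_det:
  fixes A :: "'a \<Rightarrow> complex mat"
  assumes A: "mat_lim n n A L F"
  shows "((\<lambda>t. det (A t)) \<longlongrightarrow> det L) F"
proof -
  have "((\<lambda>t. \<Sum>p | p permutes {0..<n}. signof p * (\<Prod>i=0..<n. A t $$ (i, p i))) \<longlongrightarrow>
      (\<Sum>p | p permutes {0..<n}. signof p * (\<Prod>i=0..<n. L $$ (i, p i)))) F"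
    by (intro tendsto_intros mat_limD(3)[OF A]) (auto simp: permutes_in_image)
  then have "((\<lambda>t. \<Sum>p | p permutes {0..<n}. signof p * (\<Prod>i=0..<n. A t $$ (i, p i))) \<longlongrightarrow> det L) F"
    using det_def'[OF mat_limD(1)[OF A]] by simp
  then show ?thesis
    by (rule Lim_transform_eventually)
      (use mat_limD(2)[OF A] in \<open>eventually_elim, simp only: det_def'\<close>)
qed

section \<open>Traces of limits, products, block diagonal and Kronecker matrices\<close>

definition mat_trace :: "'a :: comm_monoid_add mat \<Rightarrow> 'a" where
  "mat_trace A = (\<Sum>i<dim_row A. A $$ (i,i))"

lemma mat_lim_trace:
  fixes A :: "'a \<Rightarrow> complex mat"
  assumes A: "mat_lim n n A L F"
  shows "((\<lambda>t. mat_trace (A t)) \<longlongrightarrow> mat_trace L) F"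
proof -
  have entry: "mat_trace X = (\<Sum>i<n. X $$ (i,i))" if "X \<in> carrier_mat n n" for X :: "complex mat"
    using that by (auto simp: mat_trace_def)
  have "((\<lambda>t. \<Sum>i<n. A t $$ (i,i)) \<longlongrightarrow> (\<Sum>i<n. L $$ (i,i))) F"
    by (intro tendsto_intros mat_limD(3)[OF A]) auto
  then have "((\<lambda>t. \<Sum>i<n. A t $$ (i,i)) \<longlongrightarrow> mat_trace L) F"
    using entry mat_limD(1)[OF A] by simp
  then show ?thesis
    by (rule Lim_transform_eventually)
      (use mat_limD(2)[OF A] entry in \<open>auto elim!: eventually_mono\<close>)
qed

lemma mat_trace_mult_comm:
  fixes A B :: "'a :: comm_semiring_0 mat"
  assumes "A \<in> carrier_mat n m" "B \<in> carrier_mat m n"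
  shows "mat_trace (A * B) = mat_trace (B * A)"
proof -
  have "mat_trace (A * B) = (\<Sum>i<n. \<Sum>j<m. A $$ (i,j) * B $$ (j,i))"
    using assms by (auto simp: mat_trace_def scalar_prod_def lessThan_atLeast0 intro!: sum.cong)
  also have "\<dots> = (\<Sum>j<m. \<Sum>i<n. B $$ (j,i) * A $$ (i,j))"
    by (subst sum.swap) (simp add: mult.commute)
  also have "\<dots> = mat_trace (B * A)"
    using assms by (auto simp: mat_trace_def scalar_prod_def lessThan_atLeast0 intro!: sum.cong)
  finally show ?thesis .
qed

lemma mat_trace_four_block_diag:
  fixes A D :: "'a :: comm_monoid_add mat"
  assumes "A \<in> carrier_mat n n" "D \<in> carrier_mat m m"
  shows "mat_trace (four_block_mat A B C D) = mat_trace A + mat_trace D"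
proof -
  have "mat_trace (four_block_mat A B C D) =
      (\<Sum>i<n + m. if i < n then A $$ (i,i) else D $$ (i - n, i - n))"
    using assms by (auto simp: mat_trace_def intro!: sum.cong)
  also have "\<dots> = (\<Sum>i<n. A $$ (i,i)) + (\<Sum>i<m. D $$ (i,i))"
    by (induction m) (simp_all add: add.assoc)
  finally show ?thesis using assms by (simp add: mat_trace_def)
qed

lemma mat_trace_diag_block_mat:
  fixes As :: "'a :: comm_monoid_add mat list"
  assumes "\<forall>A\<in>set As. square_mat A"
  shows "mat_trace (diag_block_mat As) = (\<Sum>A\<leftarrow>As. mat_trace A)"
  using assms
proof (induction As)
  case Nil
  then show ?case by (simp add: mat_trace_def)
next
  case (Cons A As)
  have "square_mat (diag_block_mat As)" using Cons.prems by (intro diag_block_mat_square) auto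
  then have "diag_block_mat As \<in> carrier_mat (dim_row (diag_block_mat As)) (dim_row (diag_block_mat As))"
    by auto
  moreover have "A \<in> carrier_mat (dim_row A) (dim_row A)" using Cons.prems by auto
  ultimately have "mat_trace (diag_block_mat (A # As)) = mat_trace A + mat_trace (diag_block_mat As)"
    unfolding diag_block_mat.simps Let_def by (rule mat_trace_four_block_diag[rotated])
  moreover have "mat_trace (diag_block_mat As) = (\<Sum>A\<leftarrow>As. mat_trace A)"
    using Cons.IH Cons.prems by simp
  ultimately show ?case by simp
qed

lemma mat_trace_kronecker:
  assumes A: "A \<in> carrier_mat n n" and B: "B \<in> carrier_mat m m"
  shows "mat_trace (kronecker A B) = mat_trace A * mat_trace B"
proof -
  have "mat_trace (kronecker A B) = (\<Sum>i<n * m. A $$ (i div m, i div m) * B $$ (i mod m, i mod m))"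
    using A B by (auto simp: mat_trace_def kronecker_def intro!: sum.cong)
  also have "\<dots> = (\<Sum>p\<in>{..<n} \<times> {..<m}. A $$ (fst p, fst p) * B $$ (snd p, snd p))"
  \<comment> \<open>Division with remainder by \<open>m\<close> identifies indices with pairs; for
    \<open>m = 0\<close> both index sets are empty.\<close>
  proof (cases "m = 0")
    case False
    have "a * m + b < n * m" if "a < n" "b < m" for a b
    proof -
      have "a * m + b < Suc a * m" using that by simp
      also have "\<dots> \<le> n * m" using that by (intro mult_le_mono1) simp
      finally show ?thesis .
    qed
    then show ?thesis
      by (intro sum.reindex_bij_witness[of _ "\<lambda>p. fst p * m + snd p" "\<lambda>i. (i div m, i mod m)"])
        (use False in \<open>auto simp: less_mult_imp_div_less\<close>)
  qed auto
  also have "\<dots> = mat_trace A * mat_trace B"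
    using A B by (simp add: mat_trace_def sum_product sum.cartesian_product split_def)
  finally show ?thesis .
qed

text \<open>As a function of \<open>t\<close> the determinant is the characteristic polynomial of
  \<open>- A\<close>, which is monic and so has finitely many roots.\<close>

lemma eventually_det_add_smult_one:
  fixes A :: "complex mat"
  assumes A: "A \<in> carrier_mat n n"
  shows "\<forall>\<^sub>F t in at 0. det (A + t \<cdot>\<^sub>m 1\<^sub>m n) \<noteq> 0"
proof -
  define p where "p = char_poly (- A)"
  have p: "poly p t = det (A + t \<cdot>\<^sub>m 1\<^sub>m n)" for t
  proof -
    have "- char_matrix (- A) t = A + t \<cdot>\<^sub>m 1\<^sub>m n"
      using A by (intro eq_matI) (auto simp: char_matrix_def)
    then show ?thesis unfolding p_def using char_poly_matrix[of "- A" n t] A by simp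
  qed
  have "p \<noteq> 0"
    using degree_monic_char_poly[of "- A" n] A unfolding p_def by force
  then have "finite {t. poly p t = 0}" by (rule poly_roots_finite)
  \<comment> \<open>The point \<open>0\<close> is taken out of the root set, so that the complement
    is a neighbourhood of \<open>0\<close> even for singular \<open>A\<close>.\<close>
  then have "open (- ({t. poly p t = 0} - {0}))"
    by (intro open_Compl finite_imp_closed finite_Diff)
  then have "\<forall>\<^sub>F t in at 0. t \<notin> {t. poly p t = 0} - {0}"
    by (intro eventually_at_topological[THEN iffD2] exI[of _ "- ({t. poly p t = 0} - {0})"]) simp
  then show ?thesis
    using eventually_neq_at_within by eventually_elim (auto simp: p)
qed

lemma mat_lim_add_smult:
  fixes A N :: "complex mat"
  assumes A: "A \<in> carrier_mat n m" and N: "N \<in> carrier_mat n m"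
  shows "mat_lim n m (\<lambda>t. A + t \<cdot>\<^sub>m N) A (at 0)"
proof -
  have "((\<lambda>t. (A + t \<cdot>\<^sub>m N) $$ (i,j)) \<longlongrightarrow> A $$ (i,j)) (at 0)" if "i < n" "j < m" for i j
  proof -
    have "((\<lambda>t. A $$ (i,j) + t * N $$ (i,j)) \<longlongrightarrow> A $$ (i,j) + 0 * N $$ (i,j)) (at 0)"
      by (intro tendsto_intros)
    then show ?thesis using that A N by simp
  qed
  then show ?thesis using A N by (simp add: mat_lim_def)
qed

section \<open>Representations\<close>

lemma GL_carrier_iff: "g \<in> carrier (GL n) \<longleftrightarrow> g \<in> carrier_mat n n \<and> det g \<noteq> 0"
proof -
  have "g \<in> Units (ring_mat TYPE(complex) n ()) \<Longrightarrow> g \<in> carrier_mat n n"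
    by (auto simp: Units_def ring_mat_def)
  then show ?thesis
    unfolding GL_def units_of_def
    using unit_imp_det_non_zero[of g n "()"] det_non_zero_imp_unit[of g n "()"] by auto
qed

lemma GL_mult [simp]: "x \<otimes>\<^bsub>GL n\<^esub> y = x * y"
  by (simp add: GL_def units_of_def ring_mat_def)

lemma GL_one [simp]: "\<one>\<^bsub>GL n\<^esub> = 1\<^sub>m n"
  by (simp add: GL_def units_of_def ring_mat_def)

lemma group_GL: "group (GL n)"
proof -
  interpret ring "ring_mat TYPE(complex) n ()" by (rule ring_mat)
  show ?thesis unfolding GL_def by (rule units_group)
qed

lemma mult_GL: "g \<in> carrier (GL n) \<Longrightarrow> h \<in> carrier (GL n) \<Longrightarrow> g * h \<in> carrier (GL n)"
  by (auto simp: GL_carrier_iff det_mult)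

lemma one_GL: "1\<^sub>m n \<in> carrier (GL n)"
  by (simp add: GL_carrier_iff)

lemma rep_carrier:
  "representation r n \<rho> \<Longrightarrow> g \<in> carrier (GL r) \<Longrightarrow> \<rho> g \<in> carrier_mat n n"
  unfolding representation_def hom_def using GL_carrier_iff by blast

lemma rep_mult:
  "representation r n \<rho> \<Longrightarrow> g \<in> carrier (GL r) \<Longrightarrow> h \<in> carrier (GL r) \<Longrightarrow> \<rho> (g * h) = \<rho> g * \<rho> h"
  unfolding representation_def hom_def by auto

lemma rep_one:
  assumes "representation r n \<rho>" shows "\<rho> (1\<^sub>m r) = 1\<^sub>m n"
proof -
  have "\<rho> \<in> hom (GL r) (GL n)" using assms by (simp add: representation_def)
  from hom_one[OF this group_GL group_GL] show ?thesis by simp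
qed

lemma regular_fun_sum:
  assumes "\<And>i. i \<in> I \<Longrightarrow> regular_fun r (f i)"
  shows "regular_fun r (\<lambda>A. \<Sum>i\<in>I. f i A)"
  using assms by (induction I rule: infinite_finite_induct)
    (auto intro: regular_fun.intros)

lemma tendsto_regular_fun:
  assumes "regular_fun r f" and A: "mat_lim r r A L F" and L: "det L \<noteq> 0"
  shows "((\<lambda>t. f (A t)) \<longlongrightarrow> f L) F"
  using assms(1)
proof induction
  case inverse_det
  then show ?case by (intro tendsto_intros mat_lim_det[OF A] L)
qed (auto intro!: tendsto_intros mat_limD(3)[OF A])

text \<open>Rationality of the representation becomes continuity at invertible matrices; continuity
  of \<open>det\<close> keeps \<open>A t\<close> in the group eventually.\<close>

lemma mat_lim_rep:
  assumes \<rho>: "representation r n \<rho>" and A: "mat_lim r r A L F" and L: "det L \<noteq> 0"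
  shows "mat_lim n n (\<lambda>t. \<rho> (A t)) (\<rho> L) F"
proof -
  have "\<forall>\<^sub>F t in F. det (A t) \<noteq> 0"
    using mat_lim_det[OF A] L by (rule tendsto_imp_eventually_ne)
  then have ev: "\<forall>\<^sub>F t in F. A t \<in> carrier (GL r)"
    using mat_limD(2)[OF A] by eventually_elim (simp add: GL_carrier_iff)
  have LGL: "L \<in> carrier (GL r)" using mat_limD(1)[OF A] L by (simp add: GL_carrier_iff)
  have "((\<lambda>t. \<rho> (A t) $$ (i,j)) \<longlongrightarrow> \<rho> L $$ (i,j)) F" if ij: "i < n" "j < n" for i j
  proof -
    obtain f where f: "regular_fun r f" "\<forall>g\<in>carrier (GL r). \<rho> g $$ (i,j) = f g"
      using \<rho> ij unfolding representation_def by blast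
    have "((\<lambda>t. f (A t)) \<longlongrightarrow> \<rho> L $$ (i,j)) F"
      using tendsto_regular_fun[OF f(1) A L] f(2) LGL by simp
    then show ?thesis
      by (rule Lim_transform_eventually) (use ev in eventually_elim, use f(2) in simp)
  qed
  moreover have "\<forall>\<^sub>F t in F. \<rho> (A t) \<in> carrier_mat n n"
    using ev by eventually_elim (rule rep_carrier[OF \<rho>])
  ultimately show ?thesis
    using rep_carrier[OF \<rho> LGL] by (simp add: mat_lim_def)
qed

text \<open>No invariance of \<open>X\<close> is assumed. The vectors whose whole orbit stays in
  \<open>X\<close> form an invariant subspace \<open>W\<close> inside \<open>X\<close>, and
  \<open>x\<close> makes it non-zero.\<close>

lemma irreducible_orbit_subspace:
  assumes \<rho>: "irreducible_representation r n \<rho>" and X: "lin_subspace n X"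
    and x: "x \<in> carrier_vec n" "x \<noteq> 0\<^sub>v n"
    and orbit: "\<And>g. g \<in> carrier (GL r) \<Longrightarrow> \<rho> g *\<^sub>v x \<in> X"
  shows "X = carrier_vec n"
proof -
  have rep: "representation r n \<rho>"
    and irr: "\<And>W. lin_subspace n W \<Longrightarrow> (\<forall>g\<in>carrier (GL r). \<forall>w\<in>W. \<rho> g *\<^sub>v w \<in> W) \<Longrightarrow>
      W = {0\<^sub>v n} \<or> W = carrier_vec n"
    using \<rho> unfolding irreducible_representation_def subspace_module_vec_iff by blast+
  note c = rep_carrier[OF rep]
  define W where "W = {y \<in> carrier_vec n. \<forall>g\<in>carrier (GL r). \<rho> g *\<^sub>v y \<in> X}"
  have "lin_subspace n W"
    unfolding lin_subspace_def
  proof (intro conjI ballI allI)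
    have "\<rho> g *\<^sub>v 0\<^sub>v n = 0\<^sub>v n" if "g \<in> carrier (GL r)" for g
      using c[OF that] by (intro eq_vecI) (auto simp: scalar_prod_def)
    then show "0\<^sub>v n \<in> W" using X by (auto simp: W_def lin_subspace_def)
  next
    fix y z assume "y \<in> W" "z \<in> W"
    then show "y + z \<in> W"
      using X mult_add_distrib_mat_vec[OF c] by (auto simp: W_def lin_subspace_def)
  next
    fix a y assume "y \<in> W"
    then show "a \<cdot>\<^sub>v y \<in> W"
      using X mult_mat_vec[OF c] by (auto simp: W_def lin_subspace_def)
  qed (auto simp: W_def)
  moreover have "\<rho> g *\<^sub>v y \<in> W" if g: "g \<in> carrier (GL r)" and y: "y \<in> W" for g y
  proof -
    have yc: "y \<in> carrier_vec n" using y by (simp add: W_def)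
    have "\<rho> h *\<^sub>v (\<rho> g *\<^sub>v y) \<in> X" if h: "h \<in> carrier (GL r)" for h
    proof -
      have "\<rho> h *\<^sub>v (\<rho> g *\<^sub>v y) = \<rho> (h * g) *\<^sub>v y"
        using rep_mult[OF rep h g] assoc_mult_mat_vec[OF c[OF h] c[OF g] yc] by simp
      then show ?thesis using y mult_GL[OF h g] by (simp add: W_def)
    qed
    then show ?thesis using mult_mat_vec_carrier[OF c[OF g] yc] by (simp add: W_def)
  qed
  moreover have "x \<in> W" using x orbit by (simp add: W_def)
  ultimately have "W = carrier_vec n" using irr[of W] x by blast
  moreover have "W \<subseteq> X"
    using rep_one[OF rep] one_GL by (force simp: W_def)
  ultimately show ?thesis using X by (auto simp: lin_subspace_def)
qed

section \<open>The big cell of a maximal parabolic subgroup\<close>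

definition levi :: "nat \<Rightarrow> complex mat \<Rightarrow> complex \<Rightarrow> complex mat" where
  "levi r g t = four_block_mat g (0\<^sub>m r 1) (0\<^sub>m 1 r) (t \<cdot>\<^sub>m 1\<^sub>m 1)"

definition upper_unip :: "nat \<Rightarrow> complex mat \<Rightarrow> complex mat" where
  "upper_unip r b = four_block_mat (1\<^sub>m r) b (0\<^sub>m 1 r) (1\<^sub>m 1)"

definition lower_unip :: "nat \<Rightarrow> complex mat \<Rightarrow> complex mat" where
  "lower_unip r c = four_block_mat (1\<^sub>m r) (0\<^sub>m r 1) c (1\<^sub>m 1)"

definition leading_block :: "nat \<Rightarrow> complex mat \<Rightarrow> complex mat" where
  "leading_block r g = mat r r (\<lambda>(i,j). g $$ (i,j))"

text \<open>The cell of the maximal parabolic with blocks \<open>r\<close> and \<open>1\<close>, so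
  a single minor must be non-zero, not all leading ones; the remaining minors are left to the
  recursion on \<open>r\<close>.\<close>

definition big_cell :: "nat \<Rightarrow> complex mat set" where
  "big_cell r = {g \<in> carrier (GL (Suc r)). det (leading_block r g) \<noteq> 0}"

lemma levi_GL:
  assumes "g \<in> carrier (GL r)" "t \<noteq> 0"
  shows "levi r g t \<in> carrier (GL (Suc r))"
proof -
  have "det (levi r g t) = det g * t"
    unfolding levi_def using assms
    by (subst det_four_block_mat_lower_left_zero[of _ r _ 1]) (auto simp: GL_carrier_iff)
  then show ?thesis using assms by (auto simp: levi_def GL_carrier_iff)
qed

lemma upper_unip_GL:
  assumes "b \<in> carrier_mat r 1" shows "upper_unip r b \<in> carrier (GL (Suc r))"
proof -
  have "det (upper_unip r b) = 1"
    unfolding upper_unip_def using assms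
    by (subst det_four_block_mat_lower_left_zero[of _ r _ 1]) auto
  then show ?thesis using assms by (auto simp: upper_unip_def GL_carrier_iff)
qed

lemma lower_unip_GL:
  assumes "c \<in> carrier_mat 1 r" shows "lower_unip r c \<in> carrier (GL (Suc r))"
proof -
  have "det (lower_unip r c) = 1"
    unfolding lower_unip_def using assms
    by (subst det_four_block_mat_upper_right_zero[of _ r _ 1]) auto
  then show ?thesis using assms by (auto simp: lower_unip_def GL_carrier_iff)
qed

lemma levi_mult:
  assumes "g \<in> carrier_mat r r" "h \<in> carrier_mat r r"
  shows "levi r g s * levi r h t = levi r (g * h) (s * t)"
  unfolding levi_def using assms
  by (subst mult_four_block_mat[of _ r r _ 1 _ 1 _ _ r _ 1])
    (auto intro!: cong_four_block_mat eq_matI simp: scalar_prod_def)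

lemma levi_one: "levi r (1\<^sub>m r) 1 = 1\<^sub>m (Suc r)"
  unfolding levi_def by (intro eq_matI) auto

text \<open>Conjugation by \<open>diag(1,...,1,t)\<close> scales the last row, hence contracts lower
  unipotent elements to the identity as \<open>t\<close> tends to \<open>0\<close>.\<close>

lemma levi_lower_unip:
  assumes "c \<in> carrier_mat 1 r"
  shows "levi r (1\<^sub>m r) t * lower_unip r c = lower_unip r (t \<cdot>\<^sub>m c) * levi r (1\<^sub>m r) t"
proof -
  have "levi r (1\<^sub>m r) t * lower_unip r c =
      four_block_mat (1\<^sub>m r) (0\<^sub>m r 1) (t \<cdot>\<^sub>m c) (t \<cdot>\<^sub>m 1\<^sub>m 1)"
    unfolding levi_def lower_unip_def using assms
    by (subst mult_four_block_mat[of _ r r _ 1 _ 1 _ _ r _ 1])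
      (auto intro!: cong_four_block_mat eq_matI simp: scalar_prod_def)
  moreover have "lower_unip r (t \<cdot>\<^sub>m c) * levi r (1\<^sub>m r) t =
      four_block_mat (1\<^sub>m r) (0\<^sub>m r 1) (t \<cdot>\<^sub>m c) (t \<cdot>\<^sub>m 1\<^sub>m 1)"
    unfolding levi_def lower_unip_def using assms
    by (subst mult_four_block_mat[of _ r r _ 1 _ 1 _ _ r _ 1])
      (auto intro!: cong_four_block_mat)
  ultimately show ?thesis by simp
qed

text \<open>On the last column the same conjugation scales by the inverse of \<open>t\<close>.
  Writing the factor \<open>t\<close> on the left-hand side again leaves a unipotent element that
  tends to the identity.\<close>

lemma levi_upper_unip:
  assumes "b \<in> carrier_mat r 1"
  shows "levi r (1\<^sub>m r) t * upper_unip r (t \<cdot>\<^sub>m b) = upper_unip r b * levi r (1\<^sub>m r) t"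
proof -
  have "levi r (1\<^sub>m r) t * upper_unip r (t \<cdot>\<^sub>m b) =
      four_block_mat (1\<^sub>m r) (t \<cdot>\<^sub>m b) (0\<^sub>m 1 r) (t \<cdot>\<^sub>m 1\<^sub>m 1)"
    unfolding levi_def upper_unip_def using assms
    by (subst mult_four_block_mat[of _ r r _ 1 _ 1 _ _ r _ 1])
      (auto intro!: cong_four_block_mat)
  moreover have "upper_unip r b * levi r (1\<^sub>m r) t =
      four_block_mat (1\<^sub>m r) (t \<cdot>\<^sub>m b) (0\<^sub>m 1 r) (t \<cdot>\<^sub>m 1\<^sub>m 1)"
    unfolding levi_def upper_unip_def using assms
    by (subst mult_four_block_mat[of _ r r _ 1 _ 1 _ _ r _ 1])
      (auto intro!: cong_four_block_mat eq_matI simp: scalar_prod_def)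
  ultimately show ?thesis by simp
qed

lemma mat_lim_lower_unip:
  assumes "c \<in> carrier_mat 1 r"
  shows "mat_lim (Suc r) (Suc r) (\<lambda>t. lower_unip r (t \<cdot>\<^sub>m c)) (1\<^sub>m (Suc r)) (at 0)"
proof -
  define N where "N = four_block_mat (0\<^sub>m r r) (0\<^sub>m r 1) c (0\<^sub>m 1 1)"
  have "lower_unip r (t \<cdot>\<^sub>m c) = 1\<^sub>m (Suc r) + t \<cdot>\<^sub>m N" for t
    unfolding lower_unip_def N_def using assms by (intro eq_matI) auto
  moreover have "N \<in> carrier_mat (Suc r) (Suc r)" unfolding N_def using assms by auto
  ultimately show ?thesis using mat_lim_add_smult[of "1\<^sub>m (Suc r)" "Suc r" "Suc r" N] by simp
qed

lemma mat_lim_upper_unip: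
  assumes "b \<in> carrier_mat r 1"
  shows "mat_lim (Suc r) (Suc r) (\<lambda>t. upper_unip r (t \<cdot>\<^sub>m b)) (1\<^sub>m (Suc r)) (at 0)"
proof -
  define N where "N = four_block_mat (0\<^sub>m r r) b (0\<^sub>m 1 r) (0\<^sub>m 1 1)"
  have "upper_unip r (t \<cdot>\<^sub>m b) = 1\<^sub>m (Suc r) + t \<cdot>\<^sub>m N" for t
    unfolding upper_unip_def N_def using assms by (intro eq_matI) auto
  moreover have "N \<in> carrier_mat (Suc r) (Suc r)" unfolding N_def using assms by auto
  ultimately show ?thesis using mat_lim_add_smult[of "1\<^sub>m (Suc r)" "Suc r" "Suc r" N] by simp
qed

text \<open>Block Gaussian elimination with the leading block as pivot.\<close>

lemma big_cell_decomposition: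
  assumes g: "g \<in> big_cell r"
  obtains c A d b where "c \<in> carrier_mat 1 r" "A \<in> carrier (GL r)" "d \<noteq> 0" "b \<in> carrier_mat r 1"
    "g = lower_unip r c * (levi r A d * upper_unip r b)"
proof -
  have gc: "g \<in> carrier_mat (Suc r) (Suc r)" and dg: "det g \<noteq> 0"
    and dA: "det (leading_block r g) \<noteq> 0"
    using g by (auto simp: big_cell_def GL_carrier_iff)
  define A where "A = leading_block r g"
  define B where "B = mat r 1 (\<lambda>(i,j). g $$ (i, r))"
  define C where "C = mat 1 r (\<lambda>(i,j). g $$ (r, j))"
  have A: "A \<in> carrier_mat r r" and B: "B \<in> carrier_mat r 1" and C: "C \<in> carrier_mat 1 r"
    by (auto simp: A_def B_def C_def leading_block_def)
  have gAB: "g = four_block_mat A B C (g $$ (r,r) \<cdot>\<^sub>m 1\<^sub>m 1)"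
    using gc by (intro eq_matI) (auto simp: A_def B_def C_def leading_block_def less_Suc_eq)
  have AU: "A \<in> Units (ring_mat TYPE(complex) r ())"
    using A dA by (intro det_non_zero_imp_unit) (auto simp: A_def)
  then obtain A' where A': "A' \<in> carrier_mat r r" "A * A' = 1\<^sub>m r" "A' * A = 1\<^sub>m r"
    by (auto simp: Units_def ring_mat_def)
  define c where "c = C * A'"
  define b where "b = A' * B"
  \<comment> \<open>The Schur complement of \<open>A\<close>; it is non-zero because
    \<open>det g\<close> equals \<open>det A\<close> times \<open>d\<close>.\<close>
  define d where "d = g $$ (r,r) - (C * A' * B) $$ (0,0)"
  have c: "c \<in> carrier_mat 1 r" and b: "b \<in> carrier_mat r 1"
    using A' B C by (auto simp: c_def b_def)
  have cA: "c * A = C" using A' C A unfolding c_def by (simp add: mat_assoc carrier_matD)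
  have Ab: "A * b = B"
    using A' B A unfolding b_def by (simp add: mat_assoc[symmetric] carrier_matD)
  have "levi r A d * upper_unip r b = four_block_mat A B (0\<^sub>m 1 r) (d \<cdot>\<^sub>m 1\<^sub>m 1)"
    unfolding levi_def upper_unip_def using A b Ab
    by (subst mult_four_block_mat[of _ r r _ 1 _ 1 _ _ r _ 1]) (auto intro!: cong_four_block_mat)
  then have "lower_unip r c * (levi r A d * upper_unip r b) =
      four_block_mat A B (c * A) (c * B + d \<cdot>\<^sub>m 1\<^sub>m 1)"
    unfolding lower_unip_def using A B c
    by (simp, subst mult_four_block_mat[of _ r r _ 1 _ 1 _ _ r _ 1])
      (auto intro!: cong_four_block_mat)
  also have "c * B + d \<cdot>\<^sub>m 1\<^sub>m 1 = g $$ (r,r) \<cdot>\<^sub>m 1\<^sub>m 1"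
    using c B by (intro eq_matI) (auto simp: d_def c_def)
  finally have eq: "g = lower_unip r c * (levi r A d * upper_unip r b)"
    unfolding cA gAB[symmetric] by simp
  have lc: "levi r A d \<in> carrier_mat (Suc r) (Suc r)" using A by (auto simp: levi_def)
  have uc: "upper_unip r b \<in> carrier_mat (Suc r) (Suc r)"
    and ll: "lower_unip r c \<in> carrier_mat (Suc r) (Suc r)"
    using upper_unip_GL[OF b] lower_unip_GL[OF c] by (auto simp: GL_carrier_iff)
  have "det (levi r A d) = det A * d"
    unfolding levi_def using A
    by (subst det_four_block_mat_lower_left_zero[of _ r _ 1]) auto
  then have "d \<noteq> 0"
    using dg eq det_mult[OF ll mult_carrier_mat[OF lc uc]] det_mult[OF lc uc] by auto
  moreover have "A \<in> carrier (GL r)" using A dA by (auto simp: GL_carrier_iff A_def)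
  ultimately show thesis using that c b eq by blast
qed

text \<open>Adding \<open>t\<close> times the identity commutes with taking the leading block, so
  both determinants are characteristic polynomials in \<open>t\<close> and vanish at only finitely
  many points of the line.\<close>

lemma big_cell_dense:
  assumes g: "g \<in> carrier (GL (Suc r))"
  shows "\<forall>\<^sub>F t in at 0. g + t \<cdot>\<^sub>m 1\<^sub>m (Suc r) \<in> big_cell r"
proof -
  have gc: "g \<in> carrier_mat (Suc r) (Suc r)" using g by (simp add: GL_carrier_iff)
  have lead: "leading_block r (g + t \<cdot>\<^sub>m 1\<^sub>m (Suc r)) = leading_block r g + t \<cdot>\<^sub>m 1\<^sub>m r" for t
    using gc by (intro eq_matI) (auto simp: leading_block_def)
  have "leading_block r g \<in> carrier_mat r r" by (simp add: leading_block_def)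
  from eventually_det_add_smult_one[OF this] eventually_det_add_smult_one[OF gc]
  show ?thesis
    by eventually_elim (use gc in \<open>auto simp: big_cell_def GL_carrier_iff lead\<close>)
qed

lemma matrix_coefficient_eq_from_big_cell:
  assumes \<rho>: "representation (Suc r) n \<rho>" and \<sigma>: "representation (Suc r) m \<sigma>"
    and x: "x \<in> carrier_vec n" "y \<in> carrier_vec n" and x': "x' \<in> carrier_vec m" "y' \<in> carrier_vec m"
    and eq: "\<And>g. g \<in> big_cell r \<Longrightarrow> x \<bullet> (\<rho> g *\<^sub>v y) = x' \<bullet> (\<sigma> g *\<^sub>v y')"
    and g: "g \<in> carrier (GL (Suc r))"
  shows "x \<bullet> (\<rho> g *\<^sub>v y) = x' \<bullet> (\<sigma> g *\<^sub>v y')"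
proof -
  let ?g = "\<lambda>t. g + t \<cdot>\<^sub>m 1\<^sub>m (Suc r)"
  have gc: "g \<in> carrier_mat (Suc r) (Suc r)" "det g \<noteq> 0" using g by (auto simp: GL_carrier_iff)
  have lim: "mat_lim (Suc r) (Suc r) ?g g (at 0)" by (intro mat_lim_add_smult gc) simp
  have "((\<lambda>t. x \<bullet> (\<rho> (?g t) *\<^sub>v y)) \<longlongrightarrow> x \<bullet> (\<rho> g *\<^sub>v y)) (at 0)"
    by (intro mat_lim_scalar_prod[OF mat_lim_rep[OF \<rho> lim]] gc x)
  moreover have "((\<lambda>t. x' \<bullet> (\<sigma> (?g t) *\<^sub>v y')) \<longlongrightarrow> x' \<bullet> (\<sigma> g *\<^sub>v y')) (at 0)"
    by (intro mat_lim_scalar_prod[OF mat_lim_rep[OF \<sigma> lim]] gc x')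
  then have "((\<lambda>t. x \<bullet> (\<rho> (?g t) *\<^sub>v y)) \<longlongrightarrow> x' \<bullet> (\<sigma> g *\<^sub>v y')) (at 0)"
    by (rule Lim_transform_eventually)
      (use big_cell_dense[OF g] in \<open>eventually_elim, use eq in simp\<close>)
  ultimately show ?thesis using tendsto_unique[OF at_neq_bot] by blast
qed

text \<open>A subspace is cut out by linear equations. Each of them is a matrix coefficient
  vanishing on the big cell, hence on the whole group, so the full orbit of \<open>x\<close> lies in
  \<open>X\<close>.\<close>

lemma irreducible_big_cell_subspace:
  assumes \<rho>: "irreducible_representation (Suc r) n \<rho>" and X: "lin_subspace n X"
    and x: "x \<in> carrier_vec n" "x \<noteq> 0\<^sub>v n"
    and orbit: "\<And>g. g \<in> big_cell r \<Longrightarrow> \<rho> g *\<^sub>v x \<in> X"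
  shows "X = carrier_vec n"
proof (rule irreducible_orbit_subspace[OF \<rho> X x])
  fix g assume g: "g \<in> carrier (GL (Suc r))"
  have rep: "representation (Suc r) n \<rho>" using \<rho> by (simp add: irreducible_representation_def)
  obtain m R S where R: "R \<in> carrier_mat m n" and S: "S \<in> carrier_mat n m"
    and XRS: "X = {x \<in> carrier_vec n. S *\<^sub>v (R *\<^sub>v x) = x}"
    by (rule lin_subspace_split[OF X])
  \<comment> \<open>The rows of \<open>K\<close> are the equations of \<open>X\<close>, the fixed
    space of \<open>S * R\<close>.\<close>
  define K where "K = S * R - 1\<^sub>m n"
  have K: "K \<in> carrier_mat n n" unfolding K_def by (rule carrier_matI) simp_all
  have XK: "y \<in> X \<longleftrightarrow> (\<forall>i<n. row K i \<bullet> y = 0)" if y: "y \<in> carrier_vec n" for y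
  proof -
    have "K *\<^sub>v y = S *\<^sub>v (R *\<^sub>v y) - y"
      using R S y unfolding K_def
      by (simp add: minus_mult_distrib_mat_vec[of _ n n] mult_mat_vec_assoc carrier_matD[OF R] carrier_matD[OF S] carrier_vecD[OF y])
    moreover have "S *\<^sub>v (R *\<^sub>v y) \<in> carrier_vec n" using R S y by simp
    ultimately have "y \<in> X \<longleftrightarrow> K *\<^sub>v y = 0\<^sub>v n"
      using y carrier_matD[OF S] unfolding XRS by (auto simp: vec_eq_iff)
    also have "\<dots> \<longleftrightarrow> (\<forall>i<n. row K i \<bullet> y = 0)"
      using K by (auto simp: vec_eq_iff)
    finally show ?thesis .
  qed
  have bc: "h \<in> carrier (GL (Suc r))" if "h \<in> big_cell r" for h
    using that by (simp add: big_cell_def)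
  have "row K i \<bullet> (\<rho> g *\<^sub>v x) = 0\<^sub>v n \<bullet> (\<rho> g *\<^sub>v x)" if "i < n" for i
  proof (rule matrix_coefficient_eq_from_big_cell[OF rep rep _ _ _ _ _ g])
    show "row K i \<bullet> (\<rho> h *\<^sub>v x) = 0\<^sub>v n \<bullet> (\<rho> h *\<^sub>v x)" if h: "h \<in> big_cell r" for h
      using XK[of "\<rho> h *\<^sub>v x"] orbit[OF h] rep_carrier[OF rep bc[OF h]] x \<open>i < n\<close> by simp
  qed (use x K in auto)
  then show "\<rho> g *\<^sub>v x \<in> X"
    using XK[of "\<rho> g *\<^sub>v x"] rep_carrier[OF rep g] x by simp
qed

section \<open>Restriction to the lowest weight space of the last coordinate\<close>

lemma regular_fun_levi:
  assumes "regular_fun (Suc r) f"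
  shows "\<exists>f'. regular_fun r f' \<and> (\<forall>g\<in>carrier (GL r). f (levi r g 1) = f' g)"
  using assms
proof induction
  case (const c)
  show ?case by (rule exI[of _ "\<lambda>_. c"]) (simp add: regular_fun.const)
next
  case (entry i j)
  show ?case
  proof (cases "i < r \<and> j < r")
    case True
    then show ?thesis
      by (intro exI[of _ "\<lambda>A. A $$ (i,j)"]) (auto simp: regular_fun.entry levi_def GL_carrier_iff)
  next
    case False
    \<comment> \<open>The entries in the last row and column of the embedded matrix are constant;
      here \<open>i = j\<close> forces both indices to be \<open>r\<close>.\<close>
    then show ?thesis using entry
      by (intro exI[of _ "\<lambda>A. if i = j then 1 else 0"])
        (auto simp: regular_fun.const levi_def GL_carrier_iff)
  qed
next
  case inverse_det
  have "det (levi r g 1) = det g" if "g \<in> carrier (GL r)" for g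
    unfolding levi_def using that
    by (subst det_four_block_mat_lower_left_zero[of _ r _ 1]) (auto simp: GL_carrier_iff)
  then show ?case
    by (intro exI[of _ "\<lambda>A. inverse (det A)"]) (auto simp: regular_fun.inverse_det)
next
  case (add f1 f2)
  then obtain f1' f2' where "regular_fun r f1'" "\<forall>g\<in>carrier (GL r). f1 (levi r g 1) = f1' g"
    "regular_fun r f2'" "\<forall>g\<in>carrier (GL r). f2 (levi r g 1) = f2' g" by blast
  then show ?case by (intro exI[of _ "\<lambda>A. f1' A + f2' A"]) (auto simp: regular_fun.add)
next
  case (mult f1 f2)
  then obtain f1' f2' where "regular_fun r f1'" "\<forall>g\<in>carrier (GL r). f1 (levi r g 1) = f1' g"
    "regular_fun r f2'" "\<forall>g\<in>carrier (GL r). f2 (levi r g 1) = f2' g" by blast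
  then show ?case by (intro exI[of _ "\<lambda>A. f1' A * f2' A"]) (auto simp: regular_fun.mult)
qed

locale highest_weight_irrep =
  fixes r n :: nat and w :: "nat \<Rightarrow> int" and \<rho> :: "complex mat \<Rightarrow> complex mat" and v :: "complex vec"
  assumes irreducible: "irreducible_representation (Suc r) n \<rho>"
    and hwv: "highest_weight_vector (Suc r) w n \<rho> v"
begin

lemma rep: "representation (Suc r) n \<rho>"
  using irreducible by (simp add: irreducible_representation_def)

lemma v: "v \<in> carrier_vec n" "v \<noteq> 0\<^sub>v n"
  using hwv by (auto simp: highest_weight_vector_def)

lemmas rho_carrier = rep_carrier[OF rep]
lemmas rho_dim = rho_carrier[THEN carrier_matD(1)] rho_carrier[THEN carrier_matD(2)]
lemmas rho_mult = rep_mult[OF rep]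

lemma levi_one_GL: "t \<noteq> 0 \<Longrightarrow> levi r (1\<^sub>m r) t \<in> carrier (GL (Suc r))"
  by (intro levi_GL one_GL)

lemma upper_unip_hwv:
  assumes b: "b \<in> carrier_mat r 1" shows "\<rho> (upper_unip r b) *\<^sub>v v = v"
proof -
  have "upper_triangular (upper_unip r b)"
    unfolding upper_unip_def by (rule upper_triangular_four_block[of _ r _ 1]) auto
  then have "\<rho> (upper_unip r b) *\<^sub>v v = (\<Prod>i<Suc r. (upper_unip r b $$ (i,i)) powi (w i)) \<cdot>\<^sub>v v"
    using hwv upper_unip_GL[OF b] by (auto simp: highest_weight_vector_def)
  also have "(\<Prod>i<Suc r. (upper_unip r b $$ (i,i)) powi (w i)) = 1"
    using b by (intro prod.neutral) (auto simp: upper_unip_def)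
  finally show ?thesis by simp
qed

lemma levi_hwv:
  assumes b: "b \<in> carrier (GL r)" "upper_triangular b" and t: "t \<noteq> 0"
  shows "\<rho> (levi r b t) *\<^sub>v v = ((\<Prod>i<r. (b $$ (i,i)) powi (w i)) * t powi (w r)) \<cdot>\<^sub>v v"
proof -
  have bc: "b \<in> carrier_mat r r" using b by (simp add: GL_carrier_iff)
  have "upper_triangular (levi r b t)"
    unfolding levi_def using b bc by (intro upper_triangular_four_block[of _ r _ 1]) auto
  then have "\<rho> (levi r b t) *\<^sub>v v = (\<Prod>i<Suc r. (levi r b t $$ (i,i)) powi (w i)) \<cdot>\<^sub>v v"
    using hwv levi_GL[OF b(1) t] by (auto simp: highest_weight_vector_def)
  also have "(\<Prod>i<Suc r. (levi r b t $$ (i,i)) powi (w i)) =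
      (\<Prod>i<r. (b $$ (i,i)) powi (w i)) * t powi (w r)"
    using bc by (auto simp: levi_def intro!: prod.cong)
  finally show ?thesis .
qed

text \<open>The normalised action of \<open>diag(1,\<dots>,1,t)\<close>, which fixes the highest weight vector. Only
  \<open>t \<noteq> 0\<close> matters; the value at \<open>0\<close> makes every \<open>T t\<close> an \<open>n \<times> n\<close> matrix.\<close>

definition T :: "complex \<Rightarrow> complex mat" where
  "T t = (if t = 0 then 1\<^sub>m n else t powi (- w r) \<cdot>\<^sub>m \<rho> (levi r (1\<^sub>m r) t))"

lemma T_carrier: "T t \<in> carrier_mat n n"
  unfolding T_def using rho_carrier[OF levi_one_GL] by auto

lemmas T_dim = T_carrier[THEN carrier_matD(1)] T_carrier[THEN carrier_matD(2)]

lemma rho_levi_one: "t \<noteq> 0 \<Longrightarrow> \<rho> (levi r (1\<^sub>m r) t) = t powi (w r) \<cdot>\<^sub>m T t"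
  using rho_carrier[OF levi_one_GL]
  by (intro eq_matI) (auto simp: T_def power_int_minus)

lemma T_commute:
  assumes t: "t \<noteq> 0" and g: "g \<in> carrier (GL (Suc r))" "h \<in> carrier (GL (Suc r))"
    and eq: "levi r (1\<^sub>m r) t * g = h * levi r (1\<^sub>m r) t"
  shows "T t * \<rho> g = \<rho> h * T t"
proof -
  note l = levi_one_GL[OF t]
  have "T t * \<rho> g = t powi (- w r) \<cdot>\<^sub>m \<rho> (levi r (1\<^sub>m r) t * g)"
    using t mult_smult_assoc_mat[OF rho_carrier[OF l] rho_carrier[OF g(1)]]
    by (simp add: T_def rho_mult[OF l g(1)])
  also have "\<dots> = \<rho> h * T t"
    using t mult_smult_distrib[OF rho_carrier[OF g(2)] rho_carrier[OF l]]
    by (simp add: T_def eq rho_mult[OF g(2) l])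
  finally show ?thesis .
qed

lemma T_lower_unip:
  assumes "t \<noteq> 0" "c \<in> carrier_mat 1 r"
  shows "T t * \<rho> (lower_unip r c) = \<rho> (lower_unip r (t \<cdot>\<^sub>m c)) * T t"
  using assms by (intro T_commute lower_unip_GL levi_lower_unip) auto

lemma T_upper_unip:
  assumes "t \<noteq> 0" "b \<in> carrier_mat r 1"
  shows "T t * \<rho> (upper_unip r (t \<cdot>\<^sub>m b)) = \<rho> (upper_unip r b) * T t"
  using assms by (intro T_commute upper_unip_GL levi_upper_unip) auto

lemma T_levi:
  assumes "t \<noteq> 0" "A \<in> carrier (GL r)" "d \<noteq> 0"
  shows "T t * \<rho> (levi r A d) = \<rho> (levi r A d) * T t"
proof (rule T_commute)
  have "A \<in> carrier_mat r r" using assms by (simp add: GL_carrier_iff)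
  then show "levi r (1\<^sub>m r) t * levi r A d = levi r A d * levi r (1\<^sub>m r) t"
    by (simp add: levi_mult mult.commute)
qed (use assms levi_GL in auto)

lemma T_mult:
  assumes s: "s \<noteq> 0" and t: "t \<noteq> 0" shows "T s * T t = T (s * t)"
proof -
  note ls = rho_carrier[OF levi_one_GL[OF s]] and lt = rho_carrier[OF levi_one_GL[OF t]]
  have "\<rho> (levi r (1\<^sub>m r) s) * \<rho> (levi r (1\<^sub>m r) t) = \<rho> (levi r (1\<^sub>m r) (s * t))"
    by (simp add: rho_mult[OF levi_one_GL[OF s] levi_one_GL[OF t], symmetric] levi_mult)
  then have "T s * T t =
      s powi (- w r) \<cdot>\<^sub>m (t powi (- w r) \<cdot>\<^sub>m \<rho> (levi r (1\<^sub>m r) (s * t)))"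
    using s t mult_smult_assoc_mat[OF ls, of "t powi (- w r) \<cdot>\<^sub>m \<rho> (levi r (1\<^sub>m r) t)" n]
      mult_smult_distrib[OF ls lt] lt
    by (simp add: T_def)
  also have "\<dots> = T (s * t)"
    using s t by (intro eq_matI) (simp_all add: T_def power_int_mult_distrib)
  finally show ?thesis .
qed

lemma T_hwv:
  assumes t: "t \<noteq> 0" shows "T t *\<^sub>v v = v"
proof -
  have "\<rho> (levi r (1\<^sub>m r) t) *\<^sub>v v = t powi (w r) \<cdot>\<^sub>v v"
    using levi_hwv[OF one_GL _ t] by simp
  then show ?thesis
    using t v rho_dim[OF levi_one_GL[OF t]]
    by (simp add: T_def smult_mult_mat_vec smult_smult_assoc power_int_minus)
qed

text \<open>On the orbit of the big cell, \<open>T t\<close> turns \<open>lower_unip r c\<close> into \<open>lower_unip r (t c)\<close>, which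
  tends to the identity; the orbit spans the whole space.\<close>

lemma T_converges: "\<exists>P. mat_lim n n T P (at 0)"
proof -
  \<comment> \<open>The vectors on which the limit exists. This subspace is not visibly invariant
    under the group, so irreducibility has to enter through the big cell orbit of
    \<open>v\<close>.\<close>
  define X where "X = {x \<in> carrier_vec n. \<exists>y\<in>carrier_vec n. \<forall>i<n.
    ((\<lambda>t. (T t *\<^sub>v x) $ i) \<longlongrightarrow> y $ i) (at 0)}"
  have "lin_subspace n X"
    unfolding lin_subspace_def
  proof (intro conjI ballI allI)
    have "(T t *\<^sub>v 0\<^sub>v n) $ i = 0" if "i < n" for t i
      using that T_dim by (simp add: scalar_prod_def)
    then show "0\<^sub>v n \<in> X" by (auto simp: X_def intro!: bexI[of _ "0\<^sub>v n"])
  next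
    fix x x' assume "x \<in> X" "x' \<in> X"
    then obtain y y' where x: "x \<in> carrier_vec n" "x' \<in> carrier_vec n"
      and y: "y \<in> carrier_vec n" "y' \<in> carrier_vec n"
      and lim: "\<And>i. i < n \<Longrightarrow> ((\<lambda>t. (T t *\<^sub>v x) $ i) \<longlongrightarrow> y $ i) (at 0)"
        "\<And>i. i < n \<Longrightarrow> ((\<lambda>t. (T t *\<^sub>v x') $ i) \<longlongrightarrow> y' $ i) (at 0)"
      by (auto simp: X_def)
    have "((\<lambda>t. (T t *\<^sub>v (x + x')) $ i) \<longlongrightarrow> (y + y') $ i) (at 0)" if "i < n" for i
      using tendsto_add[OF lim[OF that]] that x y T_dim
      by (simp add: mult_add_distrib_mat_vec[OF T_carrier])
    then show "x + x' \<in> X" using x y by (auto simp: X_def intro!: bexI[of _ "y + y'"])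
  next
    fix a x assume "x \<in> X"
    then obtain y where x: "x \<in> carrier_vec n" and y: "y \<in> carrier_vec n"
      and lim: "\<And>i. i < n \<Longrightarrow> ((\<lambda>t. (T t *\<^sub>v x) $ i) \<longlongrightarrow> y $ i) (at 0)"
      by (auto simp: X_def)
    have "((\<lambda>t. (T t *\<^sub>v (a \<cdot>\<^sub>v x)) $ i) \<longlongrightarrow> (a \<cdot>\<^sub>v y) $ i) (at 0)" if "i < n" for i
      using tendsto_mult[OF tendsto_const[of a] lim[OF that]] that x y T_dim
      by (simp add: mult_mat_vec[OF T_carrier])
    then show "a \<cdot>\<^sub>v x \<in> X" using x y by (auto simp: X_def intro!: bexI[of _ "a \<cdot>\<^sub>v y"])
  qed (auto simp: X_def)
  moreover have "\<rho> g *\<^sub>v v \<in> X" if g: "g \<in> big_cell r" for g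
  proof -
    obtain c A d b where c: "c \<in> carrier_mat 1 r" and A: "A \<in> carrier (GL r)" and d: "d \<noteq> 0"
      and b: "b \<in> carrier_mat r 1" and gdec: "g = lower_unip r c * (levi r A d * upper_unip r b)"
      using big_cell_decomposition[OF g] .
    note G = lower_unip_GL[OF c] levi_GL[OF A d] upper_unip_GL[OF b]
    define y where "y = \<rho> (levi r A d) *\<^sub>v v"
    have y: "y \<in> carrier_vec n" unfolding y_def using rho_carrier[OF G(2)] v by simp
    have gv: "\<rho> g *\<^sub>v v = \<rho> (lower_unip r c) *\<^sub>v y"
      unfolding gdec y_def using v G upper_unip_hwv[OF b]
      by (simp add: rho_mult mult_GL mat_assoc rho_dim)
    have "T t *\<^sub>v (\<rho> g *\<^sub>v v) = \<rho> (lower_unip r (t \<cdot>\<^sub>m c)) *\<^sub>v y" if t: "t \<noteq> 0" for t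
    proof -
      have G': "lower_unip r (t \<cdot>\<^sub>m c) \<in> carrier (GL (Suc r))" using c by (intro lower_unip_GL) simp
      have "T t *\<^sub>v (\<rho> g *\<^sub>v v) = (T t * \<rho> (lower_unip r c)) *\<^sub>v y"
        unfolding gv using y G by (simp add: mat_assoc rho_dim T_dim)
      also have "\<dots> = \<rho> (lower_unip r (t \<cdot>\<^sub>m c)) *\<^sub>v (T t *\<^sub>v y)"
        unfolding T_lower_unip[OF t c] using y G' by (simp add: mat_assoc rho_dim T_dim)
      \<comment> \<open>\<open>T t\<close> commutes with the Levi factor and fixes \<open>v\<close>,
        so it fixes \<open>y\<close>.\<close>
      also have "T t *\<^sub>v y = (T t * \<rho> (levi r A d)) *\<^sub>v v"
        unfolding y_def using v G by (simp add: mat_assoc rho_dim T_dim)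
      also have "\<dots> = y"
        unfolding T_levi[OF t A d] y_def using v G T_hwv[OF t] by (simp add: mat_assoc rho_dim T_dim)
      finally show ?thesis .
    qed
    then have ev: "\<forall>\<^sub>F t in at 0. T t *\<^sub>v (\<rho> g *\<^sub>v v) = \<rho> (lower_unip r (t \<cdot>\<^sub>m c)) *\<^sub>v y"
      by (intro eventually_at_0I)
    have "((\<lambda>t. (T t *\<^sub>v (\<rho> g *\<^sub>v v)) $ i) \<longlongrightarrow> y $ i) (at 0)" if i: "i < n" for i
    proof -
      have lim: "mat_lim n n (\<lambda>t. \<rho> (lower_unip r (t \<cdot>\<^sub>m c))) (1\<^sub>m n) (at 0)"
        using mat_lim_rep[OF rep mat_lim_lower_unip[OF c]] rep_one[OF rep] by simp
      have "((\<lambda>t. unit_vec n i \<bullet> (\<rho> (lower_unip r (t \<cdot>\<^sub>m c)) *\<^sub>v y)) \<longlongrightarrow> unit_vec n i \<bullet> (1\<^sub>m n *\<^sub>v y)) (at 0)"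
        by (intro mat_lim_scalar_prod[OF lim] y) simp
      moreover have "unit_vec n i \<bullet> (\<rho> (lower_unip r (t \<cdot>\<^sub>m c)) *\<^sub>v y) =
          (\<rho> (lower_unip r (t \<cdot>\<^sub>m c)) *\<^sub>v y) $ i" for t
      proof -
        have "lower_unip r (t \<cdot>\<^sub>m c) \<in> carrier (GL (Suc r))" using c by (intro lower_unip_GL) simp
        then show ?thesis
          using mult_mat_vec_carrier[OF rho_carrier y] i by (simp add: scalar_prod_left_unit)
      qed
      ultimately have "((\<lambda>t. (\<rho> (lower_unip r (t \<cdot>\<^sub>m c)) *\<^sub>v y) $ i) \<longlongrightarrow> y $ i) (at 0)"
        using y i by (simp add: scalar_prod_left_unit)
      then show ?thesis
        by (rule Lim_transform_eventually) (use ev in eventually_elim, simp)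
    qed
    moreover have "\<rho> g *\<^sub>v v \<in> carrier_vec n"
      unfolding gv using rho_carrier[OF G(1)] y by simp
    ultimately show ?thesis unfolding X_def using y by blast
  qed
  ultimately have X: "X = carrier_vec n"
    by (intro irreducible_big_cell_subspace[OF irreducible _ v])
  have "\<exists>y. \<forall>i<n. ((\<lambda>t. T t $$ (i,j)) \<longlongrightarrow> y $ i) (at 0)" if j: "j < n" for j
  proof -
    have "unit_vec n j \<in> X" unfolding X by simp
    then obtain y where y: "\<forall>i<n. ((\<lambda>t. (T t *\<^sub>v unit_vec n j) $ i) \<longlongrightarrow> y $ i) (at 0)"
      by (auto simp: X_def)
    have "(T t *\<^sub>v unit_vec n j) $ i = T t $$ (i,j)" if "i < n" for t i
      using that j T_dim by (simp add: scalar_prod_right_unit)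
    with y show ?thesis by auto
  qed
  then obtain y where "\<And>i j. j < n \<Longrightarrow> i < n \<Longrightarrow> ((\<lambda>t. T t $$ (i,j)) \<longlongrightarrow> y j $ i) (at 0)"
    by metis
  then have "mat_lim n n T (mat n n (\<lambda>(i,j). y j $ i)) (at 0)"
    unfolding mat_lim_def using T_carrier by auto
  then show ?thesis by blast
qed

section \<open>The limit projection and its relations with the parabolic factors\<close>

definition P :: "complex mat" where "P = (SOME P. mat_lim n n T P (at 0))"

lemma T_lim: "mat_lim n n T P (at 0)"
  unfolding P_def using someI_ex[OF T_converges] .

lemmas P_carrier = mat_limD(1)[OF T_lim]
lemmas P_dim = P_carrier[THEN carrier_matD(1)] P_carrier[THEN carrier_matD(2)]

text \<open>The relations for \<open>P\<close> below are obtained by letting \<open>t\<close> tend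
  to \<open>0\<close> in a relation for \<open>T t\<close>.\<close>

lemma lim_eqI:
  fixes A B :: "complex \<Rightarrow> complex mat"
  assumes "mat_lim n n A L (at (0::complex))" "mat_lim n n B M (at 0)"
    and "\<And>t. t \<noteq> 0 \<Longrightarrow> A t = B t"
  shows "L = M"
proof -
  have "\<forall>\<^sub>F t in at 0. A t = B t"
    by (intro eventually_at_0I assms(3))
  then have "mat_lim n n B L (at 0)" using mat_lim_cong[OF assms(1)] by blast
  then show ?thesis by (rule mat_lim_unique[OF _ assms(2) at_neq_bot])
qed

lemma P_levi:
  assumes A: "A \<in> carrier (GL r)" and d: "d \<noteq> 0"
  shows "P * \<rho> (levi r A d) = \<rho> (levi r A d) * P"
proof (rule lim_eqI)
  note c = mat_lim_const[OF rho_carrier[OF levi_GL[OF A d]]]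
  show "mat_lim n n (\<lambda>t. T t * \<rho> (levi r A d)) (P * \<rho> (levi r A d)) (at 0)"
    by (rule mat_lim_mult[OF T_lim c])
  show "mat_lim n n (\<lambda>t. \<rho> (levi r A d) * T t) (\<rho> (levi r A d) * P) (at 0)"
    by (rule mat_lim_mult[OF c T_lim])
qed (rule T_levi[OF _ A d])

text \<open>\<open>T s * T t = T (s * t)\<close>, and replacing \<open>t\<close> by
  \<open>s * t\<close> does not affect a limit at \<open>0\<close>.\<close>

lemma T_P:
  assumes s: "s \<noteq> 0" shows "T s * P = P"
proof (rule lim_eqI)
  show "mat_lim n n (\<lambda>t. T s * T t) (T s * P) (at 0)"
    by (rule mat_lim_mult[OF mat_lim_const[OF T_carrier] T_lim])
  show "mat_lim n n (\<lambda>t. T (s * t)) P (at 0)"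
    by (rule mat_lim_compose[OF T_lim filterlim_mult_at_0[OF s]])
qed (rule T_mult[OF s])

lemma P_P: "P * P = P"
proof (rule lim_eqI)
  show "mat_lim n n (\<lambda>t. T t * P) (P * P) (at 0)"
    by (rule mat_lim_mult[OF T_lim mat_lim_const[OF P_carrier]])
  show "mat_lim n n (\<lambda>t. P) P (at 0)" by (rule mat_lim_const[OF P_carrier])
qed (rule T_P)

lemma P_hwv: "P *\<^sub>v v = v"
proof (rule eq_vecI)
  fix i assume "i < dim_vec v"
  then have i: "i < n" using v by auto
  have "((\<lambda>t. unit_vec n i \<bullet> (T t *\<^sub>v v)) \<longlongrightarrow> unit_vec n i \<bullet> (P *\<^sub>v v)) (at 0)"
    by (intro mat_lim_scalar_prod[OF T_lim] v) simp
  moreover have "\<forall>\<^sub>F t in at 0. unit_vec n i \<bullet> (T t *\<^sub>v v) = unit_vec n i \<bullet> v"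
    by (intro eventually_at_0I) (simp add: T_hwv)
  ultimately have "((\<lambda>t. unit_vec n i \<bullet> v) \<longlongrightarrow> unit_vec n i \<bullet> (P *\<^sub>v v)) (at (0::complex))"
    by (rule Lim_transform_eventually)
  then have "unit_vec n i \<bullet> (P *\<^sub>v v) = unit_vec n i \<bullet> v"
    using tendsto_unique[OF at_neq_bot _ tendsto_const] by blast
  then show "(P *\<^sub>v v) $ i = v $ i"
    using i v mult_mat_vec_carrier[OF P_carrier v(1)] by (simp add: scalar_prod_left_unit)
qed (use v P_dim in auto)

text \<open>Moving \<open>T t\<close> to the right contracts the unipotent factor to the identity,
  and the final \<open>P\<close> absorbs \<open>T t\<close>.\<close>

lemma P_lower_unip:
  assumes c: "c \<in> carrier_mat 1 r" shows "P * \<rho> (lower_unip r c) * P = P"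
proof (rule lim_eqI)
  have lim: "mat_lim n n (\<lambda>t. \<rho> (lower_unip r (t \<cdot>\<^sub>m c))) (1\<^sub>m n) (at 0)"
    using mat_lim_rep[OF rep mat_lim_lower_unip[OF c]] rep_one[OF rep] by simp
  show "mat_lim n n (\<lambda>t. T t * \<rho> (lower_unip r c) * P) (P * \<rho> (lower_unip r c) * P) (at 0)"
    by (rule mat_lim_mult[OF mat_lim_mult[OF T_lim
          mat_lim_const[OF rho_carrier[OF lower_unip_GL[OF c]]]] mat_lim_const[OF P_carrier]])
  show "mat_lim n n (\<lambda>t. \<rho> (lower_unip r (t \<cdot>\<^sub>m c)) * P) P (at 0)"
    using mat_lim_mult[OF lim mat_lim_const[OF P_carrier]] P_carrier by simp
  show "T t * \<rho> (lower_unip r c) * P = \<rho> (lower_unip r (t \<cdot>\<^sub>m c)) * P" if t: "t \<noteq> 0" for t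
  proof -
    have "lower_unip r (t \<cdot>\<^sub>m c) \<in> carrier (GL (Suc r))" using c by (intro lower_unip_GL) simp
    then show ?thesis
      unfolding T_lower_unip[OF t c] by (simp add: mat_assoc rho_dim T_dim P_dim T_P[OF t])
  qed
qed

text \<open>In terms of weights, upper unipotent elements add only components with a smaller
  exponent of \<open>t\<close>, and the image of \<open>P\<close> already has the smallest
  one.\<close>

lemma upper_unip_P:
  assumes b: "b \<in> carrier_mat r 1" shows "\<rho> (upper_unip r b) * P = P"
proof (rule lim_eqI)
  have lim: "mat_lim n n (\<lambda>t. \<rho> (upper_unip r (t \<cdot>\<^sub>m b))) (1\<^sub>m n) (at 0)"
    using mat_lim_rep[OF rep mat_lim_upper_unip[OF b]] rep_one[OF rep] by simp
  show "mat_lim n n (\<lambda>t. \<rho> (upper_unip r b) * T t) (\<rho> (upper_unip r b) * P) (at 0)"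
    by (intro mat_lim_mult[OF mat_lim_const T_lim] rho_carrier upper_unip_GL b)
  show "mat_lim n n (\<lambda>t. T t * \<rho> (upper_unip r (t \<cdot>\<^sub>m b))) P (at 0)"
    using mat_lim_mult[OF T_lim lim] P_carrier by simp
qed (simp add: T_upper_unip[OF _ b])

lemma levi_P:
  assumes A: "A \<in> carrier (GL r)" and d: "d \<noteq> 0"
  shows "\<rho> (levi r A d) * P = d powi (w r) \<cdot>\<^sub>m (\<rho> (levi r A 1) * P)"
proof -
  note G = levi_GL[OF A, of 1, simplified] levi_one_GL[OF d]
  have "A \<in> carrier_mat r r" using A by (simp add: GL_carrier_iff)
  then have "levi r A d = levi r A 1 * levi r (1\<^sub>m r) d" by (simp add: levi_mult)
  then have "\<rho> (levi r A d) * P = \<rho> (levi r A 1) * ((d powi (w r) \<cdot>\<^sub>m T d) * P)"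
    using G by (simp add: rho_mult mat_assoc rho_dim P_dim rho_levi_one[OF d] T_dim)
  also have "(d powi (w r) \<cdot>\<^sub>m T d) * P = d powi (w r) \<cdot>\<^sub>m P"
    using mult_smult_assoc_mat[OF T_carrier P_carrier] T_P[OF d] by simp
  finally show ?thesis
    using mult_smult_distrib[OF rho_carrier[OF G(1)] P_carrier] by simp
qed

text \<open>The upper unipotent factor is absorbed by the \<open>P\<close> on its right, the lower
  one by copies of \<open>P\<close> on both sides; on the image of \<open>P\<close> the entry
  \<open>d\<close> acts as a scalar.\<close>

lemma P_big_cell_P:
  assumes c: "c \<in> carrier_mat 1 r" and A: "A \<in> carrier (GL r)" and d: "d \<noteq> 0"
    and b: "b \<in> carrier_mat r 1" and gdec: "g = lower_unip r c * (levi r A d * upper_unip r b)"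
  shows "P * \<rho> g * P = d powi (w r) \<cdot>\<^sub>m (\<rho> (levi r A 1) * P)"
proof -
  note G = lower_unip_GL[OF c] levi_GL[OF A d] upper_unip_GL[OF b]
  have "P * \<rho> g * P = P * \<rho> (lower_unip r c) * (\<rho> (levi r A d) * (\<rho> (upper_unip r b) * P))"
    unfolding gdec using G by (simp add: rho_mult mult_GL mat_assoc rho_dim P_dim)
  \<comment> \<open>Idempotence frees one copy of \<open>P\<close>, which moves left past the Levi
    factor and encloses the lower unipotent one.\<close>
  also have "\<rho> (upper_unip r b) * P = P * P" by (simp add: upper_unip_P[OF b] P_P)
  also have "\<rho> (levi r A d) * (P * P) = P * (\<rho> (levi r A d) * P)"
    using G P_levi[OF A d] by (simp add: mult_mat_assoc[symmetric] rho_dim P_dim)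
  also have "P * \<rho> (lower_unip r c) * (P * (\<rho> (levi r A d) * P)) =
      (P * \<rho> (lower_unip r c) * P) * (\<rho> (levi r A d) * P)"
    using G by (simp add: mat_assoc rho_dim P_dim)
  also have "\<dots> = P * (\<rho> (levi r A d) * P)" by (simp add: P_lower_unip[OF c])
  also have "\<dots> = \<rho> (levi r A d) * (P * P)"
    using G P_levi[OF A d] by (simp add: mult_mat_assoc[symmetric] rho_dim P_dim)
  also have "\<dots> = d powi (w r) \<cdot>\<^sub>m (\<rho> (levi r A 1) * P)" by (simp add: P_P levi_P[OF A d])
  finally show ?thesis .
qed

lemma P_split:
  obtains m R S where "R \<in> carrier_mat m n" "S \<in> carrier_mat n m" "R * S = 1\<^sub>m m" "S * R = P"
proof -
  define X where "X = {x \<in> carrier_vec n. P *\<^sub>v x = x}"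
  have "lin_subspace n X"
    unfolding lin_subspace_def
  proof (intro conjI ballI allI)
    show "0\<^sub>v n \<in> X" using P_dim by (auto simp: X_def scalar_prod_def)
  qed (auto simp: X_def mult_add_distrib_mat_vec[OF P_carrier] mult_mat_vec[OF P_carrier])
  then obtain m R S where R: "R \<in> carrier_mat m n" and S: "S \<in> carrier_mat n m"
    and RS: "R * S = 1\<^sub>m m" and X: "X = {x \<in> carrier_vec n. S *\<^sub>v (R *\<^sub>v x) = x}"
    by (rule lin_subspace_split)
  note dims = carrier_matD[OF R] carrier_matD[OF S] P_dim
  have PS: "P * S = S"
  proof (rule eq_mat_by_mult_vec)
    fix y :: "complex vec" assume y: "y \<in> carrier_vec m"
    have "S *\<^sub>v (R *\<^sub>v (S *\<^sub>v y)) = S *\<^sub>v ((R * S) *\<^sub>v y)"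
      using y dims by (simp add: mat_assoc)
    then have "S *\<^sub>v y \<in> X" using y S unfolding X RS by simp
    then show "P * S *\<^sub>v y = S *\<^sub>v y" using y dims by (simp add: X_def mat_assoc)
  qed (use P_carrier S in auto)
  have SRP: "S * (R * P) = P"
  proof (rule eq_mat_by_mult_vec)
    fix y :: "complex vec" assume y: "y \<in> carrier_vec n"
    have "P *\<^sub>v (P *\<^sub>v y) = (P * P) *\<^sub>v y" using y dims by (simp add: mat_assoc)
    then have "P *\<^sub>v y \<in> X"
      using y mult_mat_vec_carrier[OF P_carrier y] unfolding P_P by (simp add: X_def)
    then show "S * (R * P) *\<^sub>v y = P *\<^sub>v y" using y dims unfolding X by (simp add: mat_assoc)
  qed (use P_carrier R S in auto)
  have "R * P * S = 1\<^sub>m m" using dims by (simp add: mat_assoc PS RS)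
  \<comment> \<open>The first splitting only ensures that \<open>S * R\<close> projects onto the
    image of \<open>P\<close>, possibly along another complement; composing \<open>R\<close> with
    \<open>P\<close> corrects the kernel.\<close>
  then show thesis using that[of "R * P" m S] R S P_carrier SRP by auto
qed

text \<open>For a splitting \<open>P = S R\<close>, \<open>R S = 1\<close>, the action of \<open>GL(r)\<close> on the image of \<open>P\<close>, in the
  coordinates given by \<open>R\<close>.\<close>

definition trunc :: "complex mat \<Rightarrow> complex mat \<Rightarrow> complex mat \<Rightarrow> complex mat" where
  "trunc R S g = R * (\<rho> (levi r g 1) * S)"

section \<open>The truncated representation of \<open>GL(r)\<close>\<close>

context
  fixes m R S
  assumes R: "R \<in> carrier_mat m n" and S: "S \<in> carrier_mat n m"
    and RS: "R * S = 1\<^sub>m m" and SR: "S * R = P"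
begin

lemma RS_dim:
  "dim_row R = m" "dim_col R = n" "dim_row S = n" "dim_col S = m"
  using R S by auto

lemma P_S: "P * S = S"
  unfolding SR[symmetric] using RS_dim RS S by (simp add: mat_assoc)

lemma R_P: "R * P = R"
  unfolding SR[symmetric] using RS_dim RS R by (simp add: mult_mat_assoc[symmetric])

lemma levi1_GL: "g \<in> carrier (GL r) \<Longrightarrow> levi r g 1 \<in> carrier (GL (Suc r))"
  by (intro levi_GL) auto

lemma rho_levi1_dim:
  "g \<in> carrier (GL r) \<Longrightarrow> dim_row (\<rho> (levi r g 1)) = n"
  "g \<in> carrier (GL r) \<Longrightarrow> dim_col (\<rho> (levi r g 1)) = n"
  by (simp_all add: rho_dim levi1_GL)

lemma trunc_carrier: "trunc R S g \<in> carrier_mat m m"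
  by (rule carrier_matI) (simp_all add: trunc_def RS_dim)

text \<open>Between the two factors stands \<open>S * R = P\<close>, which commutes with the Levi
  action and is then absorbed by \<open>S\<close>.\<close>

lemma trunc_mult:
  assumes g: "g \<in> carrier (GL r)" and h: "h \<in> carrier (GL r)"
  shows "trunc R S (g * h) = trunc R S g * trunc R S h"
proof -
  note dims = RS_dim rho_levi1_dim[OF g] rho_levi1_dim[OF h] P_dim
  have "g \<in> carrier_mat r r" "h \<in> carrier_mat r r" using g h by (auto simp: GL_carrier_iff)
  then have "levi r (g * h) 1 = levi r g 1 * levi r h 1" by (simp add: levi_mult)
  then have eq: "\<rho> (levi r (g * h) 1) = \<rho> (levi r g 1) * \<rho> (levi r h 1)"
    by (simp add: rho_mult levi1_GL g h)
  have "trunc R S g * trunc R S h = R * (\<rho> (levi r g 1) * ((S * R) * (\<rho> (levi r h 1) * S)))"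
    using dims by (simp add: trunc_def mat_assoc)
  also have "(S * R) * (\<rho> (levi r h 1) * S) = (P * \<rho> (levi r h 1)) * S"
    unfolding SR using dims by (simp add: mat_assoc)
  also have "P * \<rho> (levi r h 1) = \<rho> (levi r h 1) * P" by (rule P_levi[OF h]) simp
  also have "\<dots> * S = \<rho> (levi r h 1) * S" using dims by (simp add: mat_assoc P_S)
  finally show ?thesis using dims by (simp add: trunc_def eq mat_assoc)
qed

lemma trunc_one: "trunc R S (1\<^sub>m r) = 1\<^sub>m m"
  using S by (simp add: trunc_def levi_one rep_one[OF rep] RS)

lemma trunc_GL:
  assumes g: "g \<in> carrier (GL r)" shows "trunc R S g \<in> carrier (GL m)"
proof -
  obtain h where h: "h \<in> carrier (GL r)" "g * h = 1\<^sub>m r"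
    using group.r_inv[OF group_GL g] group.inv_closed[OF group_GL g] by auto
  have "det (trunc R S g) * det (trunc R S h) = det (1\<^sub>m m :: complex mat)"
    using trunc_mult[OF g h(1)] h(2) trunc_one det_mult[OF trunc_carrier trunc_carrier] by metis
  then show ?thesis using trunc_carrier by (auto simp: GL_carrier_iff)
qed

lemma trunc_rep: "representation r m (trunc R S)"
  unfolding representation_def
proof (intro conjI allI impI)
  show "trunc R S \<in> hom (GL r) (GL m)"
    by (auto simp: hom_def trunc_GL trunc_mult)
next
  fix i j assume ij: "i < m" "j < m"
  have "\<exists>f. regular_fun r f \<and> (\<forall>g\<in>carrier (GL r). \<rho> (levi r g 1) $$ (a,b) = f g)"
    if "a < n" "b < n" for a b
  proof -
    obtain f where "regular_fun (Suc r) f" and f: "\<forall>g\<in>carrier (GL (Suc r)). \<rho> g $$ (a,b) = f g"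
      using rep \<open>a < n\<close> \<open>b < n\<close> unfolding representation_def by blast
    then obtain f' where "regular_fun r f'" "\<forall>g\<in>carrier (GL r). f (levi r g 1) = f' g"
      using regular_fun_levi by blast
    then show ?thesis using f levi1_GL by (intro exI[of _ f']) auto
  qed
  then obtain f where freg: "\<And>a b. a < n \<Longrightarrow> b < n \<Longrightarrow> regular_fun r (f a b)"
    and f: "\<And>a b g. a < n \<Longrightarrow> b < n \<Longrightarrow> g \<in> carrier (GL r) \<Longrightarrow> \<rho> (levi r g 1) $$ (a,b) = f a b g"
    by metis
  define F where "F g = (\<Sum>a<n. R $$ (i,a) * (\<Sum>b<n. f a b g * S $$ (b,j)))" for g
  have "regular_fun r F"
    unfolding F_def by (intro regular_fun_sum regular_fun.intros freg) auto
  moreover have "trunc R S g $$ (i,j) = F g" if g: "g \<in> carrier (GL r)" for g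
    using ij RS_dim rho_levi1_dim[OF g] f[OF _ _ g]
    by (simp add: trunc_def F_def scalar_prod_def lessThan_atLeast0)
  ultimately show "\<exists>f. regular_fun r f \<and> (\<forall>g\<in>carrier (GL r). trunc R S g $$ (i,j) = f g)"
    by blast
qed

lemma trunc_hwv:
  assumes hv: "highest_weight_vector (Suc r) w n \<rho> u"
  shows "highest_weight_vector r w m (trunc R S) (R *\<^sub>v u)" "S *\<^sub>v (R *\<^sub>v u) = u"
proof -
  \<comment> \<open>\<open>T\<close> and \<open>P\<close> are built from \<open>r\<close>,
    \<open>n\<close>, \<open>w\<close> and \<open>\<rho>\<close> alone, so starting from
    \<open>u\<close> produces the same projection, and \<open>P\<close> fixes \<open>u\<close>
    too.\<close>
  interpret u: highest_weight_irrep r n w \<rho> u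
    by unfold_locales (fact irreducible, fact hv)
  have ud: "dim_vec u = n" using u.v by auto
  show SRu: "S *\<^sub>v (R *\<^sub>v u) = u"
    using u.P_hwv ud RS_dim unfolding SR[symmetric] by (simp add: mat_assoc)
  have "R *\<^sub>v u \<noteq> 0\<^sub>v m"
  proof
    assume "R *\<^sub>v u = 0\<^sub>v m"
    then have "u = S *\<^sub>v 0\<^sub>v m" using SRu by simp
    also have "\<dots> = 0\<^sub>v n" using RS_dim by (intro eq_vecI) (auto simp: scalar_prod_def)
    finally show False using u.v by simp
  qed
  moreover have "trunc R S b *\<^sub>v (R *\<^sub>v u) = (\<Prod>i<r. (b $$ (i,i)) powi (w i)) \<cdot>\<^sub>v (R *\<^sub>v u)"
    if b: "b \<in> carrier (GL r)" "upper_triangular b" for b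
  proof -
    have "trunc R S b *\<^sub>v (R *\<^sub>v u) = R *\<^sub>v (\<rho> (levi r b 1) *\<^sub>v (S *\<^sub>v (R *\<^sub>v u)))"
      using RS_dim rho_levi1_dim[OF b(1)] ud by (simp add: trunc_def mat_assoc)
    also have "\<dots> = R *\<^sub>v ((\<Prod>i<r. (b $$ (i,i)) powi (w i)) \<cdot>\<^sub>v u)"
      unfolding SRu using u.levi_hwv[OF b, of 1] by simp
    finally show ?thesis using mult_mat_vec[OF R u.v(1)] by simp
  qed
  moreover have "R *\<^sub>v u \<in> carrier_vec m" using R u.v by simp
  ultimately show "highest_weight_vector r w m (trunc R S) (R *\<^sub>v u)"
    by (simp add: highest_weight_vector_def)
qed

lemma trunc_big_cell:
  assumes c: "c \<in> carrier_mat 1 r" and A: "A \<in> carrier (GL r)" and d: "d \<noteq> 0"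
    and b: "b \<in> carrier_mat r 1" and gdec: "g = lower_unip r c * (levi r A d * upper_unip r b)"
  shows "R * \<rho> g * S = d powi (w r) \<cdot>\<^sub>m trunc R S A"
proof -
  note eq = P_big_cell_P[OF c A d b gdec]
  have gG: "g \<in> carrier (GL (Suc r))"
    unfolding gdec by (intro mult_GL lower_unip_GL levi_GL upper_unip_GL c A d b)
  note dims = RS_dim rho_levi1_dim[OF A] P_dim rho_dim[OF gG]
  have "R * \<rho> g * S = (R * P) * \<rho> g * (P * S)" by (simp add: P_S R_P)
  also have "\<dots> = R * ((P * \<rho> g * P) * S)" using dims by (simp add: mat_assoc)
  also have "\<dots> = d powi (w r) \<cdot>\<^sub>m (R * (\<rho> (levi r A 1) * (P * S)))"
  proof -
    have c: "\<rho> (levi r A 1) * P \<in> carrier_mat n n"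
      by (rule mult_carrier_mat[OF rho_carrier[OF levi1_GL[OF A]] P_carrier])
    have "d powi (w r) \<cdot>\<^sub>m (\<rho> (levi r A 1) * P) * S =
        d powi (w r) \<cdot>\<^sub>m (\<rho> (levi r A 1) * P * S)"
      by (rule mult_smult_assoc_mat[OF c S])
    then have "R * (d powi (w r) \<cdot>\<^sub>m (\<rho> (levi r A 1) * P) * S) =
        d powi (w r) \<cdot>\<^sub>m (R * (\<rho> (levi r A 1) * P * S))"
      by (simp only: mult_smult_distrib[OF R mult_carrier_mat[OF c S]])
    also have "\<rho> (levi r A 1) * P * S = \<rho> (levi r A 1) * (P * S)"
      by (rule mult_mat_assoc) (simp_all only: dims)
    finally show ?thesis unfolding eq .
  qed
  finally have "R * \<rho> g * S = d powi (w r) \<cdot>\<^sub>m trunc R S A" by (simp add: P_S trunc_def)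
  then show ?thesis .
qed

text \<open>An invariant subspace \<open>W\<close> pulls back along \<open>R\<close> to a subspace
  \<open>X\<close>. By \<open>trunc_big_cell\<close> the big cell orbit of \<open>S x\<close> stays
  in \<open>X\<close> for \<open>x\<close> in \<open>W\<close>, so \<open>X\<close> is everything,
  and applying \<open>R\<close> gives back all of the small space.\<close>

lemma trunc_irreducible: "irreducible_representation r m (trunc R S)"
  unfolding irreducible_representation_def subspace_module_vec_iff
proof (intro conjI allI impI)
  show "representation r m (trunc R S)" by (rule trunc_rep)
  have "R *\<^sub>v v \<in> carrier_vec m" "R *\<^sub>v v \<noteq> 0\<^sub>v m"
    using trunc_hwv(1)[OF hwv] by (auto simp: highest_weight_vector_def)
  moreover have "x = 0\<^sub>v m" if "m = 0" "x \<in> carrier_vec m" for x :: "complex vec"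
    using that by (intro eq_vecI) auto
  ultimately show "m > 0" by blast
  fix W assume "lin_subspace m W \<and> (\<forall>g\<in>carrier (GL r). \<forall>x\<in>W. trunc R S g *\<^sub>v x \<in> W)"
  then have W: "lin_subspace m W"
    and inv: "\<And>g x. g \<in> carrier (GL r) \<Longrightarrow> x \<in> W \<Longrightarrow> trunc R S g *\<^sub>v x \<in> W"
    by auto
  show "W = {0\<^sub>v m} \<or> W = carrier_vec m"
  proof (cases "W = {0\<^sub>v m}")
    case False
    then obtain x where x: "x \<in> W" "x \<noteq> 0\<^sub>v m" using W by (auto simp: lin_subspace_def)
    have xc: "x \<in> carrier_vec m" using x W by (auto simp: lin_subspace_def)
    have RSx: "R *\<^sub>v (S *\<^sub>v y) = y" if "y \<in> carrier_vec m" for y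
    proof -
      have "R *\<^sub>v (S *\<^sub>v y) = (R * S) *\<^sub>v y" using that RS_dim by (simp add: mat_assoc)
      then show ?thesis using that by (simp add: RS)
    qed
    have Sx: "S *\<^sub>v x \<in> carrier_vec n" using S xc by simp
    have Sx0: "S *\<^sub>v x \<noteq> 0\<^sub>v n"
    proof
      assume "S *\<^sub>v x = 0\<^sub>v n"
      then have "x = R *\<^sub>v 0\<^sub>v n" using RSx[OF xc] by simp
      also have "\<dots> = 0\<^sub>v m" using RS_dim by (intro eq_vecI) (auto simp: scalar_prod_def)
      finally show False using x by simp
    qed
    define X where "X = {y \<in> carrier_vec n. R *\<^sub>v y \<in> W}"
    have "lin_subspace n X"
      unfolding lin_subspace_def
    proof (intro conjI ballI allI)
      have "R *\<^sub>v 0\<^sub>v n = 0\<^sub>v m" using RS_dim by (intro eq_vecI) (auto simp: scalar_prod_def)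
      then show "0\<^sub>v n \<in> X" using W by (simp add: X_def lin_subspace_def)
    next
      fix y z assume "y \<in> X" "z \<in> X"
      then show "y + z \<in> X"
        using W by (simp add: X_def lin_subspace_def mult_add_distrib_mat_vec[OF R])
    next
      fix c y assume "y \<in> X"
      then show "c \<cdot>\<^sub>v y \<in> X"
        using W by (simp add: X_def lin_subspace_def mult_mat_vec[OF R])
    qed (simp add: X_def)
    moreover have "\<rho> g *\<^sub>v (S *\<^sub>v x) \<in> X" if g: "g \<in> big_cell r" for g
    proof -
      have gG: "g \<in> carrier (GL (Suc r))" using g by (simp add: big_cell_def)
      obtain c A d b where dec: "c \<in> carrier_mat 1 r" "A \<in> carrier (GL r)" "d \<noteq> 0"
        "b \<in> carrier_mat r 1" "g = lower_unip r c * (levi r A d * upper_unip r b)"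
        using big_cell_decomposition[OF g] .
      note A = dec(2) and eq = trunc_big_cell[OF dec]
      have "R *\<^sub>v (\<rho> g *\<^sub>v (S *\<^sub>v x)) = (R * \<rho> g * S) *\<^sub>v x"
        using RS_dim rho_dim[OF gG] xc by (simp add: mat_assoc)
      also have "\<dots> = d powi (w r) \<cdot>\<^sub>v (trunc R S A *\<^sub>v x)"
        unfolding eq using trunc_carrier xc by (intro smult_mult_mat_vec) auto
      also have "\<dots> \<in> W" using inv[OF A x(1)] W by (simp add: lin_subspace_def)
      finally show ?thesis
        using mult_mat_vec_carrier[OF rho_carrier[OF gG] Sx] by (simp add: X_def)
    qed
    ultimately have X: "X = carrier_vec n"
      by (intro irreducible_big_cell_subspace[OF irreducible _ Sx Sx0])
    have "y \<in> W" if y: "y \<in> carrier_vec m" for y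
    proof -
      have "S *\<^sub>v y \<in> X" unfolding X using S y by simp
      then show ?thesis by (simp add: X_def RSx[OF y])
    qed
    then have "W = carrier_vec m" using W unfolding lin_subspace_def by blast
    then show ?thesis by (rule disjI2)
  next
    case True
    then show ?thesis by (rule disjI1)
  qed
qed

text \<open>Cyclicity of the trace rewrites the truncated character as the trace of
  \<open>\<rho> (levi r g 1) * P\<close>, and \<open>P\<close> is the limit of
  \<open>T t\<close>.\<close>

lemma trunc_trace:
  assumes g: "g \<in> carrier (GL r)"
  shows "((\<lambda>t. t powi (- w r) * mat_trace (\<rho> (levi r g t))) \<longlongrightarrow> mat_trace (trunc R S g)) (at 0)"
proof -
  note dims = RS_dim rho_levi1_dim[OF g] P_dim
  have c: "\<rho> (levi r g 1) \<in> carrier_mat n n" by (rule rho_carrier[OF levi1_GL[OF g]])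
  have "mat_trace (trunc R S g) = mat_trace (\<rho> (levi r g 1) * S * R)"
    unfolding trunc_def using c R S by (intro mat_trace_mult_comm[of _ m n]) auto
  also have "\<dots> = mat_trace (\<rho> (levi r g 1) * P)" using dims by (simp add: mat_assoc SR)
  finally have tr: "mat_trace (trunc R S g) = mat_trace (\<rho> (levi r g 1) * P)" .
  have "((\<lambda>t. mat_trace (\<rho> (levi r g 1) * T t)) \<longlongrightarrow> mat_trace (trunc R S g)) (at 0)"
    unfolding tr by (rule mat_lim_trace[OF mat_lim_mult[OF mat_lim_const[OF c] T_lim]])
  moreover have "mat_trace (\<rho> (levi r g 1) * T t) = t powi (- w r) * mat_trace (\<rho> (levi r g t))"
    if t: "t \<noteq> 0" for t
  proof -
    note lt = levi_one_GL[OF t]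
    have "g \<in> carrier_mat r r" using g by (simp add: GL_carrier_iff)
    then have "levi r g t = levi r g 1 * levi r (1\<^sub>m r) t" by (simp add: levi_mult)
    then have "\<rho> (levi r g t) = \<rho> (levi r g 1) * \<rho> (levi r (1\<^sub>m r) t)"
      by (simp add: rho_mult[OF levi1_GL[OF g] lt])
    then have "\<rho> (levi r g 1) * T t = t powi (- w r) \<cdot>\<^sub>m \<rho> (levi r g t)"
      using t mult_smult_distrib[OF c rho_carrier[OF lt]] by (simp add: T_def)
    then show ?thesis
      using rho_dim[OF levi_GL[OF g t]] by (simp add: mat_trace_def sum_distrib_left)
  qed
  ultimately show ?thesis
    by (elim Lim_transform_eventually) (simp add: eventually_at_0I)
qed

end

end

text \<open>The same function \<open>w\<close> is the weight in both ranks, since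
  \<open>is_Psi r\<close> reads only its first \<open>r\<close> entries.\<close>

lemma is_Psi_truncation:
  assumes "is_Psi (Suc r) w n \<rho>"
  obtains m \<tau> where "is_Psi r w m \<tau>"
    "\<And>g. g \<in> carrier (GL r) \<Longrightarrow>
      ((\<lambda>t. t powi (- w r) * mat_trace (\<rho> (levi r g t))) \<longlongrightarrow> mat_trace (\<tau> g)) (at 0)"
proof -
  obtain u where u: "highest_weight_vector (Suc r) w n \<rho> u" and
    irr: "irreducible_representation (Suc r) n \<rho>"
    using assms by (auto simp: is_Psi_def)
  interpret highest_weight_irrep r n w \<rho> u by unfold_locales (fact irr, fact u)
  obtain m R S where RS: "R \<in> carrier_mat m n" "S \<in> carrier_mat n m" "R * S = 1\<^sub>m m" "S * R = P"
    by (rule P_split)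
  have "is_Psi r w m (trunc R S)"
    unfolding is_Psi_def by (intro conjI exI) (fact trunc_irreducible[OF RS] trunc_hwv(1)[OF RS u])+
  then show thesis by (rule that[OF _ trunc_trace[OF RS]])
qed

section \<open>The character is determined by the highest weight\<close>

text \<open>On the big cell both coefficients are \<open>d powi (w r)\<close> times coefficients of
  the truncations at the Levi part, which agree by induction on the rank; density extends the
  equality to the group.\<close>

lemma highest_weight_matrix_coefficients_agree:
  assumes "irreducible_representation r n \<rho>" "highest_weight_vector r w n \<rho> v"
    and "irreducible_representation r m \<sigma>" "highest_weight_vector r w m \<sigma> v'"
  shows "\<exists>x\<in>carrier_vec n. \<exists>x'\<in>carrier_vec m. x \<bullet> v \<noteq> 0 \<and>
    (\<forall>g\<in>carrier (GL r). x \<bullet> (\<rho> g *\<^sub>v v) = x' \<bullet> (\<sigma> g *\<^sub>v v'))"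
  using assms
proof (induction r arbitrary: n \<rho> v m \<sigma> v')
  case 0
  \<comment> \<open>\<open>GL(0)\<close> is trivial, so it suffices to take functionals with value
    \<open>1\<close> at \<open>v\<close> and at \<open>v'\<close>.\<close>
  have dual: "\<exists>x\<in>carrier_vec k. x \<bullet> u = 1" if u: "u \<in> carrier_vec k" "u \<noteq> 0\<^sub>v k" for k and u :: "complex vec"
  proof -
    have "u = 0\<^sub>v k" if "\<forall>i<k. u $ i = 0"
      using that \<open>u \<in> carrier_vec k\<close> by (intro eq_vecI) auto
    then obtain i where "i < k" "u $ i \<noteq> 0" using u(2) by blast
    then have "((1 / u $ i) \<cdot>\<^sub>v unit_vec k i) \<bullet> u = 1"
      using u by (simp add: scalar_prod_left_unit)
    then show ?thesis by (intro bexI[of _ "(1 / u $ i) \<cdot>\<^sub>v unit_vec k i"]) auto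
  qed
  have v: "v \<in> carrier_vec n" "v \<noteq> 0\<^sub>v n" "v' \<in> carrier_vec m" "v' \<noteq> 0\<^sub>v m"
    using 0 by (auto simp: highest_weight_vector_def)
  then obtain x x' where x: "x \<in> carrier_vec n" "x \<bullet> v = 1" "x' \<in> carrier_vec m" "x' \<bullet> v' = 1"
    using dual by meson
  have "\<rho> (1\<^sub>m 0) = 1\<^sub>m n" "\<sigma> (1\<^sub>m 0) = 1\<^sub>m m"
    using 0 rep_one by (auto simp: irreducible_representation_def)
  moreover have "g = 1\<^sub>m 0" if "g \<in> carrier (GL 0)" for g
    using that by (intro eq_matI) (auto simp: GL_carrier_iff)
  ultimately have "x \<bullet> (\<rho> g *\<^sub>v v) = x' \<bullet> (\<sigma> g *\<^sub>v v')" if "g \<in> carrier (GL 0)" for g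
    using that x v by auto
  then show ?case using x by (intro bexI[of _ x] bexI[of _ x']) auto
next
  case (Suc r)
  interpret a: highest_weight_irrep r n w \<rho> v by unfold_locales (fact Suc.prems)+
  interpret b: highest_weight_irrep r m w \<sigma> v' by unfold_locales (fact Suc.prems)+
  obtain k R S where RS: "R \<in> carrier_mat k n" "S \<in> carrier_mat n k" "R * S = 1\<^sub>m k" "S * R = a.P"
    by (rule a.P_split)
  obtain k' R' S' where RS': "R' \<in> carrier_mat k' m" "S' \<in> carrier_mat m k'"
    "R' * S' = 1\<^sub>m k'" "S' * R' = b.P"
    by (rule b.P_split)
  note hw = a.trunc_hwv[OF RS Suc.prems(2)] and hw' = b.trunc_hwv[OF RS' Suc.prems(4)]
  obtain y y' where y: "y \<in> carrier_vec k" and y': "y' \<in> carrier_vec k'" and ne: "y \<bullet> (R *\<^sub>v v) \<noteq> 0"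
    and eq: "\<And>g. g \<in> carrier (GL r) \<Longrightarrow>
      y \<bullet> (a.trunc R S g *\<^sub>v (R *\<^sub>v v)) = y' \<bullet> (b.trunc R' S' g *\<^sub>v (R' *\<^sub>v v'))"
    using Suc.IH[OF a.trunc_irreducible[OF RS] hw(1) b.trunc_irreducible[OF RS'] hw'(1)] by blast
  \<comment> \<open>The functional \<open>y\<close> on the truncation, pulled back along
    \<open>R\<close>.\<close>
  define x where "x = transpose_mat R *\<^sub>v y"
  define x' where "x' = transpose_mat R' *\<^sub>v y'"
  have x: "x \<in> carrier_vec n" and x': "x' \<in> carrier_vec m"
    using RS(1) RS'(1) y y' by (auto simp: x_def x'_def)
  have xu: "x \<bullet> u = y \<bullet> (R *\<^sub>v u)" if "u \<in> carrier_vec n" for u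
    unfolding x_def using transpose_vec_mult_scalar[OF RS(1) that y] .
  have xu': "x' \<bullet> u = y' \<bullet> (R' *\<^sub>v u)" if "u \<in> carrier_vec m" for u
    unfolding x'_def using transpose_vec_mult_scalar[OF RS'(1) that y'] .
  have "x \<bullet> (\<rho> g *\<^sub>v v) = x' \<bullet> (\<sigma> g *\<^sub>v v')" if g: "g \<in> big_cell r" for g
  proof -
    obtain c A d b where dec: "c \<in> carrier_mat 1 r" "A \<in> carrier (GL r)" "d \<noteq> 0"
      "b \<in> carrier_mat r 1" "g = lower_unip r c * (levi r A d * upper_unip r b)"
      using big_cell_decomposition[OF g] .
    have gG: "g \<in> carrier (GL (Suc r))" using g by (simp add: big_cell_def)
    have "R *\<^sub>v (\<rho> g *\<^sub>v v) = (R * \<rho> g * S) *\<^sub>v (R *\<^sub>v v)"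
      using hw(2) RS(1,2) a.v(1) a.rho_dim[OF gG] by (simp add: mat_assoc)
    also have "\<dots> = d powi (w r) \<cdot>\<^sub>v (a.trunc R S A *\<^sub>v (R *\<^sub>v v))"
      unfolding a.trunc_big_cell[OF RS dec] using a.trunc_carrier[OF RS] RS(1)
      by (intro smult_mult_mat_vec) auto
    finally have 1: "x \<bullet> (\<rho> g *\<^sub>v v) = d powi (w r) * (y \<bullet> (a.trunc R S A *\<^sub>v (R *\<^sub>v v)))"
      using xu[of "\<rho> g *\<^sub>v v"] a.rho_carrier[OF gG] a.v(1) by (simp add: scalar_prod_smult_vec)
    have "R' *\<^sub>v (\<sigma> g *\<^sub>v v') = (R' * \<sigma> g * S') *\<^sub>v (R' *\<^sub>v v')"
      using hw'(2) RS'(1,2) b.v(1) b.rho_dim[OF gG] by (simp add: mat_assoc)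
    also have "\<dots> = d powi (w r) \<cdot>\<^sub>v (b.trunc R' S' A *\<^sub>v (R' *\<^sub>v v'))"
      unfolding b.trunc_big_cell[OF RS' dec] using b.trunc_carrier[OF RS'] RS'(1)
      by (intro smult_mult_mat_vec) auto
    finally have "x' \<bullet> (\<sigma> g *\<^sub>v v') = d powi (w r) * (y' \<bullet> (b.trunc R' S' A *\<^sub>v (R' *\<^sub>v v')))"
      using xu'[of "\<sigma> g *\<^sub>v v'"] b.rho_carrier[OF gG] b.v(1) by (simp add: scalar_prod_smult_vec)
    then show ?thesis unfolding 1 eq[OF dec(2)] by simp
  qed
  then have "\<forall>g\<in>carrier (GL (Suc r)). x \<bullet> (\<rho> g *\<^sub>v v) = x' \<bullet> (\<sigma> g *\<^sub>v v')"
    using matrix_coefficient_eq_from_big_cell[OF a.rep b.rep x a.v(1) x' b.v(1)] by blast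
  moreover have "x \<bullet> v \<noteq> 0" using xu[OF a.v(1)] ne by simp
  ultimately show ?case using x x' by blast
qed

section \<open>Intertwiners between models of the same highest weight\<close>

lemma linear_map_matrix:
  fixes f :: "complex vec \<Rightarrow> complex vec"
  assumes f: "\<And>x. x \<in> carrier_vec n \<Longrightarrow> f x \<in> carrier_vec m"
    and add: "\<And>x y. x \<in> carrier_vec n \<Longrightarrow> y \<in> carrier_vec n \<Longrightarrow> f (x + y) = f x + f y"
    and smult: "\<And>c x. x \<in> carrier_vec n \<Longrightarrow> f (c \<cdot>\<^sub>v x) = c \<cdot>\<^sub>v f x"
  obtains A where "A \<in> carrier_mat m n" "\<And>x. x \<in> carrier_vec n \<Longrightarrow> f x = A *\<^sub>v x"
proof -
  define A where "A = mat m n (\<lambda>(i,j). f (unit_vec n j) $ i)"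
  have "f x = A *\<^sub>v x" if x: "x \<in> carrier_vec n" for x
  proof (rule eq_vecI)
    fix i assume "i < dim_vec (A *\<^sub>v x)"
    then have i: "i < m" by (simp add: A_def)
    \<comment> \<open>The truncations of \<open>x\<close> to its first \<open>k\<close> coordinates,
      so that additivity is used one unit vector at a time.\<close>
    define p where "p k = vec n (\<lambda>j. if j < k then x $ j else 0)" for k
    have "f (p k) $ i = (\<Sum>j<k. f (unit_vec n j) $ i * x $ j)" if "k \<le> n" for k
      using that
    proof (induction k)
      case 0
      have "p 0 = 0 \<cdot>\<^sub>v unit_vec n 0" by (intro eq_vecI) (auto simp: p_def)
      then show ?case using i f[of "unit_vec n 0"] smult[of "unit_vec n 0" 0] by simp
    next
      case (Suc k)
      have "p (Suc k) = p k + x $ k \<cdot>\<^sub>v unit_vec n k"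
        using Suc.prems by (intro eq_vecI) (auto simp: p_def unit_vec_def less_Suc_eq)
      then have "f (p (Suc k)) = f (p k) + x $ k \<cdot>\<^sub>v f (unit_vec n k)"
        using add[of "p k" "x $ k \<cdot>\<^sub>v unit_vec n k"] smult[of "unit_vec n k"] by (simp add: p_def)
      then show ?case
        using Suc i f[of "p k"] f[of "unit_vec n k"] by (simp add: p_def mult.commute)
    qed
    moreover have "p n = x" using x by (intro eq_vecI) (auto simp: p_def)
    ultimately show "f x $ i = (A *\<^sub>v x) $ i"
      using i x by (auto simp: A_def scalar_prod_def lessThan_atLeast0 intro!: sum.cong)
  qed (use f[OF x] in \<open>auto simp: A_def\<close>)
  moreover have "A \<in> carrier_mat m n" by (simp add: A_def)
  ultimately show thesis by (intro that)
qed

text \<open>Otherwise the kernel of \<open>x\<close>, a proper subspace, would contain the orbit of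
  a non-zero vector.\<close>

lemma irreducible_functional_nondegenerate:
  assumes \<rho>: "irreducible_representation r n \<rho>" and x: "x \<in> carrier_vec n"
    and v: "v \<in> carrier_vec n" "x \<bullet> v \<noteq> 0"
    and y: "y \<in> carrier_vec n" "\<And>g. g \<in> carrier (GL r) \<Longrightarrow> x \<bullet> (\<rho> g *\<^sub>v y) = 0"
  shows "y = 0\<^sub>v n"
proof (rule ccontr)
  assume "y \<noteq> 0\<^sub>v n"
  define X where "X = {z \<in> carrier_vec n. x \<bullet> z = 0}"
  have "lin_subspace n X"
    unfolding lin_subspace_def X_def
    using x by (auto simp: scalar_prod_add_distrib[OF x])
  moreover have "representation r n \<rho>" using \<rho> by (simp add: irreducible_representation_def)
  then have "\<rho> g *\<^sub>v y \<in> X" if "g \<in> carrier (GL r)" for g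
    using y that mult_mat_vec_carrier[OF rep_carrier] by (simp add: X_def)
  ultimately have "X = carrier_vec n"
    using irreducible_orbit_subspace[OF \<rho> _ y(1) \<open>y \<noteq> 0\<^sub>v n\<close>] by blast
  then show False using v by (auto simp: X_def)
qed

text \<open>Each pair consists of the images of one element of the group algebra. Pairs record the
  correspondence of \<open>A\<close> and \<open>A'\<close> without presupposing that
  \<open>A\<close> determines \<open>A'\<close>.\<close>

inductive_set group_algebra_image ::
    "nat \<Rightarrow> (complex mat \<Rightarrow> complex mat) \<Rightarrow> (complex mat \<Rightarrow> complex mat) \<Rightarrow> (complex mat \<times> complex mat) set"
  for r \<rho> \<sigma> where
  group: "g \<in> carrier (GL r) \<Longrightarrow> (\<rho> g, \<sigma> g) \<in> group_algebra_image r \<rho> \<sigma>"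
| add: "(A, A') \<in> group_algebra_image r \<rho> \<sigma> \<Longrightarrow> (B, B') \<in> group_algebra_image r \<rho> \<sigma> \<Longrightarrow>
    (A + B, A' + B') \<in> group_algebra_image r \<rho> \<sigma>"
| smult: "(A, A') \<in> group_algebra_image r \<rho> \<sigma> \<Longrightarrow> (c \<cdot>\<^sub>m A, c \<cdot>\<^sub>m A') \<in> group_algebra_image r \<rho> \<sigma>"

text \<open>The intertwiner sends \<open>A v\<close> to \<open>A' v'\<close> for every pair \<open>(A, A')\<close>; the matrix coefficients
  detect vectors, so this is well defined.\<close>

lemma intertwiner_from_matrix_coefficients:
  assumes \<rho>: "irreducible_representation r n \<rho>" and \<sigma>: "irreducible_representation r m \<sigma>"
    and x: "x \<in> carrier_vec n" and x': "x' \<in> carrier_vec m"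
    and v: "v \<in> carrier_vec n" and v': "v' \<in> carrier_vec m" and ne: "x \<bullet> v \<noteq> 0"
    and eq: "\<And>g. g \<in> carrier (GL r) \<Longrightarrow> x \<bullet> (\<rho> g *\<^sub>v v) = x' \<bullet> (\<sigma> g *\<^sub>v v')"
  obtains \<Phi> where "\<Phi> \<in> carrier_mat m n" "\<Phi> *\<^sub>v v = v'"
    "\<And>g. g \<in> carrier (GL r) \<Longrightarrow> \<Phi> * \<rho> g = \<sigma> g * \<Phi>"
proof -
  let ?A = "group_algebra_image r \<rho> \<sigma>"
  have rep: "representation r n \<rho>" "representation r m \<sigma>"
    using \<rho> \<sigma> by (auto simp: irreducible_representation_def)
  note c = rep_carrier[OF rep(1)] rep_carrier[OF rep(2)]
  have "A \<in> carrier_mat n n \<and> A' \<in> carrier_mat m m" if "(A, A') \<in> ?A" for A A'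
    using that by induction (auto dest: c)
  then have carr: "A \<in> carrier_mat n n \<and> A' \<in> carrier_mat m m \<and>
      dim_row A = n \<and> dim_col A = n \<and> dim_row A' = m \<and> dim_col A' = m" if "(A, A') \<in> ?A" for A A'
    using that by blast
  have [simp]: "dim_vec v = n" "dim_vec v' = m" using v v' by auto
  have one: "(1\<^sub>m n, 1\<^sub>m m) \<in> ?A"
    using group_algebra_image.group[OF one_GL, where r = r and \<rho> = \<rho> and \<sigma> = \<sigma>] rep_one[OF rep(1)] rep_one[OF rep(2)] by simp
  have ne': "x' \<bullet> v' \<noteq> 0"
    using eq[OF one_GL] ne v v' rep_one[OF rep(1)] rep_one[OF rep(2)] by simp
  have mult: "(\<rho> g * A, \<sigma> g * A') \<in> ?A" if A: "(A, A') \<in> ?A" and g: "g \<in> carrier (GL r)" for A A' g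
    using A
  proof induction
    case (group h)
    then show ?case
      using group_algebra_image.group[OF mult_GL[OF g group], where \<rho> = \<rho> and \<sigma> = \<sigma>]
      by (simp add: rep_mult[OF rep(1) g group] rep_mult[OF rep(2) g group])
  next
    case (add A A' B B')
    then show ?case
      using group_algebra_image.add[OF add.IH] carr[OF add.hyps(1)] carr[OF add.hyps(2)]
      by (simp add: mult_add_distrib_mat[OF c(1)[OF g], of _ n] mult_add_distrib_mat[OF c(2)[OF g], of _ m])
  next
    case (smult A A' a)
    then show ?case
      using group_algebra_image.smult[OF smult.IH, of a] carr[OF smult.hyps]
      by (simp add: mult_smult_distrib[OF c(1)[OF g], of _ n] mult_smult_distrib[OF c(2)[OF g], of _ m])
  qed
  have coeff: "x \<bullet> (A *\<^sub>v v) = x' \<bullet> (A' *\<^sub>v v')" if "(A, A') \<in> ?A" for A A'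
    using that
  proof induction
    case (group g)
    then show ?case by (rule eq)
  next
    case (add A A' B B')
    then show ?case
      using carr[OF add.hyps(1)] carr[OF add.hyps(2)] v v'
      by (simp add: add_mult_distrib_mat_vec[of _ n n] add_mult_distrib_mat_vec[of _ m m] scalar_prod_add_vec)
  next
    case (smult A A' a)
    then show ?case
      using carr[OF smult.hyps] v v'
      by (simp add: smult_mult_mat_vec scalar_prod_smult_vec)
  qed
  have welldef: "A' *\<^sub>v v' = B' *\<^sub>v v'"
    if A: "(A, A') \<in> ?A" and B: "(B, B') \<in> ?A" and AB: "A *\<^sub>v v = B *\<^sub>v v" for A A' B B'
  proof -
    define D where "D = A + (-1) \<cdot>\<^sub>m B"
    define D' where "D' = A' + (-1) \<cdot>\<^sub>m B'"
    have D: "(D, D') \<in> ?A"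
      unfolding D_def D'_def by (intro group_algebra_image.intros A B)
    note cs = carr[OF A] carr[OF B] carr[OF D]
    have "D *\<^sub>v v = A *\<^sub>v v + (-1) \<cdot>\<^sub>v (B *\<^sub>v v)"
      unfolding D_def using cs v
      by (simp add: add_mult_distrib_mat_vec[of _ n n] smult_mult_mat_vec)
    also have "\<dots> = 0\<^sub>v n" unfolding AB using cs v by (intro eq_vecI) auto
    finally have Dv: "D *\<^sub>v v = 0\<^sub>v n" .
    \<comment> \<open>Every coefficient of \<open>\<sigma> g\<close> at \<open>D' v'\<close> equals
      the one of \<open>\<rho> g\<close> at \<open>D v = 0\<close>, and the functional
      \<open>x'\<close> is nondegenerate along orbits.\<close>
    have "D' *\<^sub>v v' = 0\<^sub>v m"
    proof (rule irreducible_functional_nondegenerate[OF \<sigma> x' v' ne'])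
      fix g assume g: "g \<in> carrier (GL r)"
      have "x' \<bullet> (\<sigma> g *\<^sub>v (D' *\<^sub>v v')) = x' \<bullet> ((\<sigma> g * D') *\<^sub>v v')"
        using cs v' c(2)[OF g] by (simp add: mat_assoc)
      also have "\<dots> = x \<bullet> ((\<rho> g * D) *\<^sub>v v)"
        using coeff[OF mult[OF D g]] by simp
      also have "(\<rho> g * D) *\<^sub>v v = \<rho> g *\<^sub>v 0\<^sub>v n"
        using cs v c(1)[OF g] Dv by (simp add: mat_assoc)
      also have "x \<bullet> \<dots> = 0" using c(1)[OF g] x by (auto simp: scalar_prod_def)
      finally show "x' \<bullet> (\<sigma> g *\<^sub>v (D' *\<^sub>v v')) = 0" .
    next
      show "D' *\<^sub>v v' \<in> carrier_vec m" using cs by (intro mult_mat_vec_carrier[OF _ v']) simp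
    qed
    moreover have "D' *\<^sub>v v' = A' *\<^sub>v v' + (-1) \<cdot>\<^sub>v (B' *\<^sub>v v')"
      unfolding D'_def using cs v'
      by (simp add: add_mult_distrib_mat_vec[of _ m m] smult_mult_mat_vec)
    ultimately have "\<And>i. i < m \<Longrightarrow> (A' *\<^sub>v v' + (-1) \<cdot>\<^sub>v (B' *\<^sub>v v')) $ i = 0" by simp
    then show ?thesis using cs v' by (intro eq_vecI) auto
  qed
  have v0: "v \<noteq> 0\<^sub>v n" using ne x by auto
  define X where "X = {A *\<^sub>v v | A A'. (A, A') \<in> ?A}"
  have "lin_subspace n X"
    unfolding lin_subspace_def
  proof (intro conjI ballI allI)
    show "X \<subseteq> carrier_vec n"
    proof
      fix y assume "y \<in> X"
      then obtain A A' where A: "(A, A') \<in> ?A" and y: "y = A *\<^sub>v v" unfolding X_def by blast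
      show "y \<in> carrier_vec n"
        unfolding y using carr[OF A] by (intro mult_mat_vec_carrier[OF _ v]) simp
    qed
    have "(0 \<cdot>\<^sub>m 1\<^sub>m n) *\<^sub>v v = 0\<^sub>v n"
      using v by (subst smult_mult_mat_vec) (auto intro: eq_vecI)
    then have "0\<^sub>v n = (0 \<cdot>\<^sub>m 1\<^sub>m n) *\<^sub>v v" ..
    then show "0\<^sub>v n \<in> X" unfolding X_def using group_algebra_image.smult[OF one, of 0] by blast
  next
    fix y z assume "y \<in> X" "z \<in> X"
    then obtain A A' B B' where AB: "(A, A') \<in> ?A" "(B, B') \<in> ?A" "y = A *\<^sub>v v" "z = B *\<^sub>v v"
      by (auto simp: X_def)
    then have "y + z = (A + B) *\<^sub>v v"
      using carr[OF AB(1)] carr[OF AB(2)] v by (simp add: add_mult_distrib_mat_vec[of _ n n])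
    then show "y + z \<in> X" unfolding X_def using group_algebra_image.add[OF AB(1,2)] by blast
  next
    fix a y assume "y \<in> X"
    then obtain A A' where A: "(A, A') \<in> ?A" "y = A *\<^sub>v v" by (auto simp: X_def)
    then have "a \<cdot>\<^sub>v y = (a \<cdot>\<^sub>m A) *\<^sub>v v"
      using carr[OF A(1)] v by (simp add: smult_mult_mat_vec)
    then show "a \<cdot>\<^sub>v y \<in> X" unfolding X_def using group_algebra_image.smult[OF A(1)] by blast
  qed
  moreover have "\<rho> g *\<^sub>v v \<in> X" if "g \<in> carrier (GL r)" for g
    unfolding X_def using group_algebra_image.group[OF that] by blast
  ultimately have "X = carrier_vec n" using irreducible_orbit_subspace[OF \<rho> _ v v0] by blast
  then have "\<exists>A A'. (A, A') \<in> ?A \<and> y = A *\<^sub>v v" if "y \<in> carrier_vec n" for y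
    using that unfolding X_def by blast
  \<comment> \<open>An arbitrary choice of a pair carrying \<open>v\<close> to \<open>y\<close>; by
    \<open>welldef\<close> the value \<open>f y\<close> does not depend on it.\<close>
  then obtain \<alpha> \<alpha>' where \<alpha>: "\<And>y. y \<in> carrier_vec n \<Longrightarrow> (\<alpha> y, \<alpha>' y) \<in> ?A"
    and \<alpha>v: "\<And>y. y \<in> carrier_vec n \<Longrightarrow> \<alpha> y *\<^sub>v v = y"
    by metis
  define f where "f y = \<alpha>' y *\<^sub>v v'" for y
  have f: "f (A *\<^sub>v v) = A' *\<^sub>v v'" if "(A, A') \<in> ?A" for A A'
  proof -
    have Av: "A *\<^sub>v v \<in> carrier_vec n"
      using carr[OF that] by (intro mult_mat_vec_carrier[OF _ v]) simp
    show ?thesis unfolding f_def by (rule welldef[OF \<alpha>[OF Av] that \<alpha>v[OF Av]])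
  qed
  have fc: "f y \<in> carrier_vec m" if "y \<in> carrier_vec n" for y
    unfolding f_def using carr[OF \<alpha>[OF that]] by (intro mult_mat_vec_carrier[OF _ v']) simp
  have fadd: "f (y + z) = f y + f z" if y: "y \<in> carrier_vec n" and z: "z \<in> carrier_vec n" for y z
  proof -
    note cs = carr[OF \<alpha>[OF y]] carr[OF \<alpha>[OF z]]
    have "(\<alpha> y + \<alpha> z) *\<^sub>v v = y + z"
      using cs v \<alpha>v[OF y] \<alpha>v[OF z] by (simp add: add_mult_distrib_mat_vec[of _ n n])
    then have "f (y + z) = (\<alpha>' y + \<alpha>' z) *\<^sub>v v'"
      using f[OF group_algebra_image.add[OF \<alpha>[OF y] \<alpha>[OF z]]] by simp
    then show ?thesis using cs v' by (simp add: f_def add_mult_distrib_mat_vec[of _ m m])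
  qed
  have fsmult: "f (a \<cdot>\<^sub>v y) = a \<cdot>\<^sub>v f y" if y: "y \<in> carrier_vec n" for a y
  proof -
    note cs = carr[OF \<alpha>[OF y]]
    have "(a \<cdot>\<^sub>m \<alpha> y) *\<^sub>v v = a \<cdot>\<^sub>v y" using cs v \<alpha>v[OF y] by (simp add: smult_mult_mat_vec)
    then have "f (a \<cdot>\<^sub>v y) = (a \<cdot>\<^sub>m \<alpha>' y) *\<^sub>v v'"
      using f[OF group_algebra_image.smult[OF \<alpha>[OF y]], of a] by simp
    then show ?thesis using cs v' by (simp add: f_def smult_mult_mat_vec)
  qed
  obtain \<Phi> where \<Phi>: "\<Phi> \<in> carrier_mat m n" and \<Phi>f: "\<And>y. y \<in> carrier_vec n \<Longrightarrow> f y = \<Phi> *\<^sub>v y"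
    using linear_map_matrix[of n f m, OF fc fadd fsmult] by blast
  have "\<Phi> *\<^sub>v v = v'" using f[OF one] \<Phi>f[OF v] v v' by simp
  moreover have "\<Phi> * \<rho> g = \<sigma> g * \<Phi>" if g: "g \<in> carrier (GL r)" for g
  proof (rule eq_mat_by_mult_vec)
    fix y :: "complex vec" assume y: "y \<in> carrier_vec n"
    note cs = carr[OF \<alpha>[OF y]] c(1)[OF g] c(2)[OF g]
    have "\<Phi> * \<rho> g *\<^sub>v y = f (\<rho> g *\<^sub>v y)" using \<Phi> y cs \<Phi>f[of "\<rho> g *\<^sub>v y"] by (simp add: mat_assoc)
    also have "\<rho> g *\<^sub>v y = (\<rho> g * \<alpha> y) *\<^sub>v v" using \<alpha>v[OF y] cs v by (simp add: mat_assoc)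
    also have "f \<dots> = (\<sigma> g * \<alpha>' y) *\<^sub>v v'" by (rule f[OF mult[OF \<alpha>[OF y] g]])
    also have "\<dots> = \<sigma> g *\<^sub>v f y" using cs v' by (simp add: mat_assoc f_def)
    also have "\<dots> = \<sigma> g * \<Phi> *\<^sub>v y" using \<Phi>f[OF y] \<Phi> y cs by (simp add: mat_assoc)
    finally show "\<Phi> * \<rho> g *\<^sub>v y = \<sigma> g * \<Phi> *\<^sub>v y" .
  qed (use \<Phi> c(1)[OF g] c(2)[OF g] in auto)
  ultimately show thesis using that \<Phi> by blast
qed

text \<open>A form of Schur's lemma without eigenvalues: the fixed space of \<open>E\<close> is a
  subspace containing the orbit of \<open>v\<close>.\<close>

lemma irreducible_fixing_intertwiner_eq_one:
  assumes \<rho>: "irreducible_representation r n \<rho>" and v: "v \<in> carrier_vec n" "v \<noteq> 0\<^sub>v n"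
    and E: "E \<in> carrier_mat n n" "E *\<^sub>v v = v"
    and comm: "\<And>g. g \<in> carrier (GL r) \<Longrightarrow> E * \<rho> g = \<rho> g * E"
  shows "E = 1\<^sub>m n"
proof -
  define X where "X = {y \<in> carrier_vec n. E *\<^sub>v y = y}"
  have rep: "representation r n \<rho>" using \<rho> by (simp add: irreducible_representation_def)
  have "lin_subspace n X"
    unfolding lin_subspace_def
  proof (intro conjI ballI allI)
    have "E *\<^sub>v 0\<^sub>v n = 0\<^sub>v n" using E(1) by (intro eq_vecI) (auto simp: scalar_prod_def)
    then show "0\<^sub>v n \<in> X" by (simp add: X_def)
  qed (auto simp: X_def mult_add_distrib_mat_vec[OF E(1)] mult_mat_vec[OF E(1)])
  moreover have "\<rho> g *\<^sub>v v \<in> X" if g: "g \<in> carrier (GL r)" for g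
  proof -
    note cg = rep_carrier[OF rep g]
    have "E *\<^sub>v (\<rho> g *\<^sub>v v) = (E * \<rho> g) *\<^sub>v v" using E v cg by (simp add: mat_assoc)
    also have "\<dots> = \<rho> g *\<^sub>v (E *\<^sub>v v)" unfolding comm[OF g] using E(1) v cg by (simp add: mat_assoc)
    finally show ?thesis using E(2) mult_mat_vec_carrier[OF cg v(1)] by (simp add: X_def)
  qed
  ultimately have "X = carrier_vec n" using irreducible_orbit_subspace[OF \<rho> _ v] by blast
  then show ?thesis by (intro eq_mat_by_mult_vec[OF E(1)]) (auto simp: X_def)
qed

text \<open>Intertwiners in both directions exchange \<open>v\<close> and \<open>v'\<close>, so
  their composites fix these vectors and are identities.\<close>

lemma is_Psi_trace_unique:
  assumes "is_Psi r w n \<rho>" "is_Psi r w m \<sigma>" and g: "g \<in> carrier (GL r)"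
  shows "mat_trace (\<rho> g) = mat_trace (\<sigma> g)"
proof -
  obtain v v' where irr: "irreducible_representation r n \<rho>" "irreducible_representation r m \<sigma>"
    and hw: "highest_weight_vector r w n \<rho> v" "highest_weight_vector r w m \<sigma> v'"
    using assms by (auto simp: is_Psi_def)
  have v: "v \<in> carrier_vec n" "v \<noteq> 0\<^sub>v n" "v' \<in> carrier_vec m" "v' \<noteq> 0\<^sub>v m"
    using hw by (auto simp: highest_weight_vector_def)
  have rep: "representation r n \<rho>" "representation r m \<sigma>"
    using irr by (auto simp: irreducible_representation_def)
  obtain x x' where x: "x \<in> carrier_vec n" "x' \<in> carrier_vec m" and ne: "x \<bullet> v \<noteq> 0"
    and eq: "\<And>g. g \<in> carrier (GL r) \<Longrightarrow> x \<bullet> (\<rho> g *\<^sub>v v) = x' \<bullet> (\<sigma> g *\<^sub>v v')"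
    using highest_weight_matrix_coefficients_agree[OF irr(1) hw(1) irr(2) hw(2)] by blast
  have ne': "x' \<bullet> v' \<noteq> 0"
    using eq[OF one_GL] ne v rep_one[OF rep(1)] rep_one[OF rep(2)] by simp
  obtain \<Phi> where \<Phi>: "\<Phi> \<in> carrier_mat m n" "\<Phi> *\<^sub>v v = v'"
    "\<And>g. g \<in> carrier (GL r) \<Longrightarrow> \<Phi> * \<rho> g = \<sigma> g * \<Phi>"
    using intertwiner_from_matrix_coefficients[OF irr x v(1) v(3) ne eq] by blast
  obtain \<Psi> where \<Psi>: "\<Psi> \<in> carrier_mat n m" "\<Psi> *\<^sub>v v' = v"
    "\<And>g. g \<in> carrier (GL r) \<Longrightarrow> \<Psi> * \<sigma> g = \<rho> g * \<Psi>"
    using intertwiner_from_matrix_coefficients[OF irr(2,1) x(2,1) v(3,1) ne' eq[symmetric]] by blast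
  have inv: "\<Psi> * \<Phi> = 1\<^sub>m n"
  proof (rule irreducible_fixing_intertwiner_eq_one[OF irr(1) v(1,2)])
    show "\<Psi> * \<Phi> *\<^sub>v v = v" using \<Phi>(1,2) \<Psi>(1,2) v(1) by (simp add: mat_assoc)
    fix h assume h: "h \<in> carrier (GL r)"
    note ch = rep_carrier[OF rep(1) h] rep_carrier[OF rep(2) h]
    have "\<Psi> * \<Phi> * \<rho> h = \<Psi> * (\<Phi> * \<rho> h)" using \<Phi>(1) \<Psi>(1) ch by (simp add: mat_assoc)
    also have "\<dots> = (\<Psi> * \<sigma> h) * \<Phi>" unfolding \<Phi>(3)[OF h] using \<Phi>(1) \<Psi>(1) ch by (simp add: mat_assoc)
    also have "\<dots> = \<rho> h * (\<Psi> * \<Phi>)" unfolding \<Psi>(3)[OF h] using \<Phi>(1) \<Psi>(1) ch by (simp add: mat_assoc)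
    finally show "\<Psi> * \<Phi> * \<rho> h = \<rho> h * (\<Psi> * \<Phi>)" .
  qed (use \<Phi>(1) \<Psi>(1) in auto)
  have inv': "\<Phi> * \<Psi> = 1\<^sub>m m"
  proof (rule irreducible_fixing_intertwiner_eq_one[OF irr(2) v(3,4)])
    show "\<Phi> * \<Psi> *\<^sub>v v' = v'" using \<Phi>(1,2) \<Psi>(1,2) v(3) by (simp add: mat_assoc)
    fix h assume h: "h \<in> carrier (GL r)"
    note ch = rep_carrier[OF rep(1) h] rep_carrier[OF rep(2) h]
    have "\<Phi> * \<Psi> * \<sigma> h = \<Phi> * (\<Psi> * \<sigma> h)" using \<Phi>(1) \<Psi>(1) ch by (simp add: mat_assoc)
    also have "\<dots> = (\<Phi> * \<rho> h) * \<Psi>" unfolding \<Psi>(3)[OF h] using \<Phi>(1) \<Psi>(1) ch by (simp add: mat_assoc)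
    also have "\<dots> = \<sigma> h * (\<Phi> * \<Psi>)" unfolding \<Phi>(3)[OF h] using \<Phi>(1) \<Psi>(1) ch by (simp add: mat_assoc)
    finally show "\<Phi> * \<Psi> * \<sigma> h = \<sigma> h * (\<Phi> * \<Psi>)" .
  qed (use \<Phi>(1) \<Psi>(1) in auto)
  note cg = rep_carrier[OF rep(1) g] rep_carrier[OF rep(2) g]
  have "mat_trace (\<rho> g) = mat_trace (\<rho> g * (\<Psi> * \<Phi>))" unfolding inv using cg by simp
  also have "\<rho> g * (\<Psi> * \<Phi>) = \<Psi> * \<sigma> g * \<Phi>"
    unfolding \<Psi>(3)[OF g] using \<Phi>(1) \<Psi>(1) cg by (simp add: mat_assoc)
  also have "mat_trace \<dots> = mat_trace (\<Phi> * (\<Psi> * \<sigma> g))"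
    using \<Phi>(1) \<Psi>(1) cg by (intro mat_trace_mult_comm[of _ n m]) auto
  also have "\<Phi> * (\<Psi> * \<sigma> g) = \<sigma> g"
    using \<Phi>(1) \<Psi>(1) cg inv' by (simp add: mult_mat_assoc[symmetric])
  finally show ?thesis .
qed

section \<open>Linear independence of the characters\<close>

lemma tendsto_power_int_at_0:
  assumes "0 \<le> k"
  shows "((\<lambda>t :: complex. t powi k) \<longlongrightarrow> (if k = 0 then 1 else 0)) (at 0)"
proof -
  have "((\<lambda>t :: complex. t ^ nat k) \<longlongrightarrow> 0 ^ nat k) (at 0)" by (intro tendsto_intros)
  then show ?thesis using assms by (auto simp: power_int_def power_0_left)
qed

text \<open>Normalising by a smaller exponent than the leading one leaves a factor
  \<open>t powi (a - k)\<close>, which tends to \<open>0\<close> unless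
  \<open>a = k\<close>.\<close>

lemma tendsto_shifted_leading_term:
  fixes f :: "complex \<Rightarrow> complex"
  assumes f: "((\<lambda>t. t powi (- a) * f t) \<longlongrightarrow> c) (at 0)" and k: "k \<le> a"
  shows "((\<lambda>t. t powi (- k) * f t) \<longlongrightarrow> (if a = k then c else 0)) (at 0)"
proof -
  have "((\<lambda>t. t powi (a - k) * (t powi (- a) * f t)) \<longlongrightarrow> (if a - k = 0 then 1 else 0) * c) (at 0)"
    using k by (intro tendsto_mult tendsto_power_int_at_0 f) simp
  then have "((\<lambda>t. t powi (a - k) * (t powi (- a) * f t)) \<longlongrightarrow> (if a = k then c else 0)) (at 0)"
    by (simp split: if_splits)
  then show ?thesis
  proof (rule Lim_transform_eventually)
    have "t powi (a - k) * (t powi (- a) * f t) = t powi (- k) * f t" if "t \<noteq> 0" for t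
      using that by (simp add: mult.assoc[symmetric] power_int_add[symmetric])
    then show "\<forall>\<^sub>F t in at 0. t powi (a - k) * (t powi (- a) * f t) = t powi (- k) * f t"
      by (rule eventually_at_0I)
  qed
qed

lemma is_Psi_trace_one:
  assumes "is_Psi r w n \<rho>"
  shows "mat_trace (\<rho> (1\<^sub>m r)) = of_nat n" "n > 0"
  using assms rep_one[of r n \<rho>]
  by (auto simp: is_Psi_def irreducible_representation_def mat_trace_def)

lemma is_Psi_truncation_family:
  assumes "\<And>\<nu>. \<nu> \<in> N \<Longrightarrow> is_Psi (Suc r) \<nu> (d \<nu>) (\<psi> \<nu>)"
  obtains m \<tau> where "\<forall>\<nu>\<in>N. is_Psi r \<nu> (m \<nu>) (\<tau> \<nu>)"
    "\<forall>\<nu>\<in>N. \<forall>g\<in>carrier (GL r).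
      ((\<lambda>t. t powi (- \<nu> r) * mat_trace (\<psi> \<nu> (levi r g t))) \<longlongrightarrow> mat_trace (\<tau> \<nu> g)) (at 0)"
proof -
  have "\<forall>\<nu>\<in>N. \<exists>q. is_Psi r \<nu> (fst q) (snd q) \<and> (\<forall>g\<in>carrier (GL r).
      ((\<lambda>t. t powi (- \<nu> r) * mat_trace (\<psi> \<nu> (levi r g t))) \<longlongrightarrow> mat_trace (snd q g)) (at 0))"
  proof
    fix \<nu> assume "\<nu> \<in> N"
    obtain m \<tau> where "is_Psi r \<nu> m \<tau>" "\<And>g. g \<in> carrier (GL r) \<Longrightarrow>
      ((\<lambda>t. t powi (- \<nu> r) * mat_trace (\<psi> \<nu> (levi r g t))) \<longlongrightarrow> mat_trace (\<tau> g)) (at 0)"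
      using is_Psi_truncation[OF assms[OF \<open>\<nu> \<in> N\<close>]] by blast
    then show "\<exists>q. is_Psi r \<nu> (fst q) (snd q) \<and> (\<forall>g\<in>carrier (GL r).
      ((\<lambda>t. t powi (- \<nu> r) * mat_trace (\<psi> \<nu> (levi r g t))) \<longlongrightarrow> mat_trace (snd q g)) (at 0))"
      by (intro exI[of _ "(m, \<tau>)"]) simp
  qed
  from bchoice[OF this] obtain q where "\<forall>\<nu>\<in>N. is_Psi r \<nu> (fst (q \<nu>)) (snd (q \<nu>)) \<and> (\<forall>g\<in>carrier (GL r).
      ((\<lambda>t. t powi (- \<nu> r) * mat_trace (\<psi> \<nu> (levi r g t))) \<longlongrightarrow> mat_trace (snd (q \<nu>) g)) (at 0))" ..
  then show thesis by (intro that[of "\<lambda>\<nu>. fst (q \<nu>)" "\<lambda>\<nu>. snd (q \<nu>)"]) blast+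
qed

text \<open>Dividing a relation by the smallest power of \<open>t\<close> and letting
  \<open>t\<close> tend to \<open>0\<close> leaves a relation of rank \<open>r\<close> among the
  weights with the smallest last entry, and these differ already in their first \<open>r\<close>
  entries.\<close>

lemma characters_linearly_independent:
  assumes "finite N" and "\<And>\<nu>. \<nu> \<in> N \<Longrightarrow> is_Psi r \<nu> (d \<nu>) (\<psi> \<nu>)"
    and "\<And>\<nu> \<mu>. \<nu> \<in> N \<Longrightarrow> \<mu> \<in> N \<Longrightarrow> (\<forall>i<r. \<nu> i = \<mu> i) \<Longrightarrow> \<nu> = \<mu>"
    and "\<And>g. g \<in> carrier (GL r) \<Longrightarrow> (\<Sum>\<nu>\<in>N. D \<nu> * mat_trace (\<psi> \<nu> g)) = 0"
    and "\<nu> \<in> N"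
  shows "D \<nu> = 0"
  using assms
proof (induction r arbitrary: N d \<psi> D \<nu>)
  case 0
  \<comment> \<open>In rank \<open>0\<close> the separation hypothesis identifies all weights in
    \<open>N\<close>.\<close>
  have "N = {\<nu>}" using 0 by auto
  then have "D \<nu> * mat_trace (\<psi> \<nu> (1\<^sub>m 0)) = 0" using 0(4)[OF one_GL] by simp
  then show ?case using is_Psi_trace_one[OF 0(2)[OF 0(5)]] by simp
next
  case (Suc r)
  obtain m \<tau> where \<tau>_all: "\<forall>\<mu>\<in>N. is_Psi r \<mu> (m \<mu>) (\<tau> \<mu>)"
    and lim_all: "\<forall>\<mu>\<in>N. \<forall>g\<in>carrier (GL r).
      ((\<lambda>t. t powi (- \<mu> r) * mat_trace (\<psi> \<mu> (levi r g t))) \<longlongrightarrow> mat_trace (\<tau> \<mu> g)) (at 0)"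
    by (rule is_Psi_truncation_family[OF Suc.prems(2)])
  note \<tau> = bspec[OF \<tau>_all] and lim = bspec[OF bspec[OF lim_all]]
  \<comment> \<open>Only non-zero coefficients are kept, so that the minimum is attained at some
    \<open>\<kappa>\<close> with \<open>D \<kappa>\<close> non-zero, which the induction
    contradicts.\<close>
  define M where "M = {\<mu> \<in> N. D \<mu> \<noteq> 0}"
  have finM: "finite M" and MN: "M \<subseteq> N" using Suc.prems(1) by (auto simp: M_def)
  show ?case
  proof (rule ccontr)
    assume "D \<nu> \<noteq> 0"
    then have M: "M \<noteq> {}" using Suc.prems(5) by (auto simp: M_def)
    define k where "k = Min ((\<lambda>\<mu>. \<mu> r) ` M)"
    have k_le: "k \<le> \<mu> r" if "\<mu> \<in> M" for \<mu> using finM that by (simp add: k_def)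
    have "k \<in> (\<lambda>\<mu>. \<mu> r) ` M" unfolding k_def using finM M by (intro Min_in) auto
    then obtain \<kappa> where \<kappa>: "\<kappa> \<in> M" "\<kappa> r = k" by auto
    define K where "K = {\<mu> \<in> M. \<mu> r = k}"
    have "(\<Sum>\<mu>\<in>K. D \<mu> * mat_trace (\<tau> \<mu> g)) = 0" if g: "g \<in> carrier (GL r)" for g
    proof -
      have lim_sum: "((\<lambda>t. \<Sum>\<mu>\<in>M. D \<mu> * (t powi (- k) * mat_trace (\<psi> \<mu> (levi r g t)))) \<longlongrightarrow>
          (\<Sum>\<mu>\<in>M. D \<mu> * (if \<mu> r = k then mat_trace (\<tau> \<mu> g) else 0))) (at 0)"
        using MN by (intro tendsto_sum tendsto_mult tendsto_const tendsto_shifted_leading_term lim k_le g) auto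
      have limit: "(\<Sum>\<mu>\<in>M. D \<mu> * (if \<mu> r = k then mat_trace (\<tau> \<mu> g) else 0)) =
          (\<Sum>\<mu>\<in>K. D \<mu> * mat_trace (\<tau> \<mu> g))"
        unfolding K_def using finM by (intro sum.mono_neutral_cong_right) auto
      have "\<forall>\<^sub>F t in at 0. (\<Sum>\<mu>\<in>M. D \<mu> * (t powi (- k) * mat_trace (\<psi> \<mu> (levi r g t)))) = 0"
      proof (rule eventually_at_0I)
        fix t :: complex assume t: "t \<noteq> 0"
        have "(\<Sum>\<mu>\<in>M. D \<mu> * mat_trace (\<psi> \<mu> (levi r g t))) = (\<Sum>\<mu>\<in>N. D \<mu> * mat_trace (\<psi> \<mu> (levi r g t)))"
          unfolding M_def using Suc.prems(1) by (intro sum.mono_neutral_left) auto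
        also have "\<dots> = 0" by (rule Suc.prems(4)[OF levi_GL[OF g t]])
        finally have "t powi (- k) * (\<Sum>\<mu>\<in>M. D \<mu> * mat_trace (\<psi> \<mu> (levi r g t))) = 0" by simp
        then show "(\<Sum>\<mu>\<in>M. D \<mu> * (t powi (- k) * mat_trace (\<psi> \<mu> (levi r g t)))) = 0"
          by (simp add: sum_distrib_left mult.left_commute)
      qed
      from tendsto_unique[OF at_neq_bot Lim_transform_eventually[OF lim_sum this] tendsto_const]
      show ?thesis unfolding limit .
    qed
    moreover have "\<mu> = \<mu>'" if "\<mu> \<in> K" "\<mu>' \<in> K" "\<forall>i<r. \<mu> i = \<mu>' i" for \<mu> \<mu>'
      using that Suc.prems(3)[of \<mu> \<mu>'] MN by (auto simp: K_def less_Suc_eq)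
    moreover have "finite K" "K \<subseteq> N" "\<kappa> \<in> K" using finM MN \<kappa> by (auto simp: K_def)
    ultimately have "D \<kappa> = 0" using Suc.IH[of K m \<tau> D \<kappa>] \<tau> by blast
    then show False using \<kappa> by (simp add: M_def)
  qed
qed

section \<open>Tensor product multiplicities\<close>

lemma isomorphic_reps_trace:
  assumes iso: "isomorphic_reps r n \<rho> m \<sigma>" and g: "g \<in> carrier (GL r)"
    and \<rho>: "\<rho> g \<in> carrier_mat n n" and \<sigma>: "\<sigma> g \<in> carrier_mat m m"
  shows "mat_trace (\<rho> g) = mat_trace (\<sigma> g)"
proof -
  obtain P where P: "P \<in> carrier (GL n)" and eq: "P * \<rho> g = \<sigma> g * P" and nm: "n = m"
    using iso g by (auto simp: isomorphic_reps_def)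
  obtain Q where Q: "Q \<in> carrier (GL n)" "P * Q = 1\<^sub>m n" "Q * P = 1\<^sub>m n"
    using group.r_inv[OF group_GL P] group.l_inv[OF group_GL P] group.inv_closed[OF group_GL P] by auto
  have c: "P \<in> carrier_mat n n" "Q \<in> carrier_mat n n" "\<sigma> g \<in> carrier_mat n n"
    using P Q \<sigma> nm by (auto simp: GL_carrier_iff)
  have "mat_trace (\<rho> g) = mat_trace (Q * P * \<rho> g)" using \<rho> Q by simp
  also have "Q * P * \<rho> g = Q * (P * \<rho> g)" using c \<rho> by (simp add: mat_assoc)
  also have "\<dots> = Q * (\<sigma> g * P)" by (simp only: eq)
  also have "mat_trace \<dots> = mat_trace (\<sigma> g * P * Q)"
    using c by (intro mat_trace_mult_comm[of _ n n]) auto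
  also have "\<sigma> g * P * Q = \<sigma> g" using c Q by (simp add: mat_assoc)
  finally show ?thesis .
qed

text \<open>Traces turn the isomorphism into an identity of characters, and grouping equal entries
  of the list turns its repetitions into the coefficients \<open>C \<nu>\<close>.\<close>

lemma tensor_decomposition_characters:
  assumes "tensor_decomposition r lam mu C"
  obtains n \<rho> m \<sigma> \<nu>s d \<psi> where "is_Psi r lam n \<rho>" "is_Psi r mu m \<sigma>"
    "\<forall>\<nu>\<in>set \<nu>s. dominant_weight r \<nu>" "\<forall>\<nu>\<in>set \<nu>s. is_Psi r \<nu> (d \<nu>) (\<psi> \<nu>)"
    "\<forall>g\<in>carrier (GL r).
      mat_trace (\<rho> g) * mat_trace (\<sigma> g) = (\<Sum>\<nu>\<in>set \<nu>s. of_nat (C \<nu>) * mat_trace (\<psi> \<nu> g))"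
    "\<forall>\<nu>. C \<nu> > 0 \<longleftrightarrow> \<nu> \<in> set \<nu>s"
proof -
  obtain n \<rho> m \<sigma> d \<psi> \<nu>s where \<rho>: "is_Psi r lam n \<rho>" and \<sigma>: "is_Psi r mu m \<sigma>"
    and \<psi>: "\<And>\<nu>. \<nu> \<in> set \<nu>s \<Longrightarrow> dominant_weight r \<nu> \<and> is_Psi r \<nu> (d \<nu>) (\<psi> \<nu>)"
    and iso: "isomorphic_reps r (n * m) (\<lambda>g. kronecker (\<rho> g) (\<sigma> g))
      (\<Sum>\<nu>\<leftarrow>\<nu>s. d \<nu>) (\<lambda>g. diag_block_mat (map (\<lambda>\<nu>. \<psi> \<nu> g) \<nu>s))"
    and C: "\<And>\<nu>. C \<nu> = count_list \<nu>s \<nu>"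
    using assms unfolding tensor_decomposition_def by blast
  have car: "\<tau> g \<in> carrier_mat k k" if "is_Psi r w k \<tau>" "g \<in> carrier (GL r)" for w k \<tau> g
    using that rep_carrier by (auto simp: is_Psi_def irreducible_representation_def)
  have "mat_trace (\<rho> g) * mat_trace (\<sigma> g) = (\<Sum>\<nu>\<in>set \<nu>s. of_nat (C \<nu>) * mat_trace (\<psi> \<nu> g))"
    if g: "g \<in> carrier (GL r)" for g
  proof -
    have dim: "dim_row (\<psi> \<nu> g) = d \<nu>" "dim_col (\<psi> \<nu> g) = d \<nu>" if "\<nu> \<in> set \<nu>s" for \<nu>
      using car[OF _ g] \<psi>[OF that] by blast+
    let ?M = "map (\<lambda>\<nu>. \<psi> \<nu> g) \<nu>s"
    have dims: "sum_list (map dim_row ?M) = (\<Sum>\<nu>\<leftarrow>\<nu>s. d \<nu>)" "sum_list (map dim_col ?M) = (\<Sum>\<nu>\<leftarrow>\<nu>s. d \<nu>)"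
      using dim by (auto simp: o_def intro!: arg_cong[of _ _ sum_list])
    have "diag_block_mat ?M \<in> carrier_mat (\<Sum>\<nu>\<leftarrow>\<nu>s. d \<nu>) (\<Sum>\<nu>\<leftarrow>\<nu>s. d \<nu>)"
      by (rule carrier_matI) (simp_all only: dim_diag_block_mat dims)
    moreover have "kronecker (\<rho> g) (\<sigma> g) \<in> carrier_mat (n * m) (n * m)"
      using car[OF \<rho> g] car[OF \<sigma> g] by (auto simp: kronecker_def)
    ultimately have "mat_trace (kronecker (\<rho> g) (\<sigma> g)) = mat_trace (diag_block_mat ?M)"
      using isomorphic_reps_trace[OF iso g] by simp
    also have "\<dots> = (\<Sum>A\<leftarrow>?M. mat_trace A)"
      using dim by (intro mat_trace_diag_block_mat) auto
    also have "\<dots> = (\<Sum>\<nu>\<leftarrow>\<nu>s. mat_trace (\<psi> \<nu> g))" by (simp add: o_def)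
    also have "\<dots> = (\<Sum>\<nu>\<in>set \<nu>s. of_nat (count_list \<nu>s \<nu>) * mat_trace (\<psi> \<nu> g))"
    proof -
      have "(\<Sum>x\<leftarrow>xs. f x) = (\<Sum>x\<in>set xs. of_nat (count_list xs x) * f x)"
        for xs and f :: "(nat \<Rightarrow> int) \<Rightarrow> complex"
      proof (induction xs)
        case (Cons a xs)
        have "(\<Sum>x\<in>set (a # xs). of_nat (count_list (a # xs) x) * f x) =
            (\<Sum>x\<in>insert a (set xs). of_nat (count_list xs x) * f x + (if x = a then f x else 0))"
          by (intro sum.cong) (auto simp: algebra_simps)
        also have "\<dots> = (\<Sum>x\<in>insert a (set xs). of_nat (count_list xs x) * f x) + f a"
          by (simp add: sum.distrib del: sum.insert)
        also have "(\<Sum>x\<in>insert a (set xs). of_nat (count_list xs x) * f x) =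
            (\<Sum>x\<in>set xs. of_nat (count_list xs x) * f x)"
          \<comment> \<open>If \<open>a\<close> does not occur in \<open>xs\<close>, its count there
            is \<open>0\<close> and the extra index contributes nothing.\<close>
          by (intro sum.mono_neutral_right) (auto simp: count_list_0_iff)
        finally show ?case using Cons by simp
      qed simp
      then show ?thesis .
    qed
    finally show ?thesis using mat_trace_kronecker[OF car[OF \<rho> g] car[OF \<sigma> g]] by (simp add: C)
  qed
  moreover have "C \<nu> > 0 \<longleftrightarrow> \<nu> \<in> set \<nu>s" for \<nu>
    using count_list_0_iff[of \<nu>s \<nu>] by (auto simp: C)
  ultimately show thesis using that \<rho> \<sigma> \<psi> by blast
qed

lemma seq_length_le_imp_zero:
  assumes w: "nonneg_decreasing_seq w" and r: "seq_length w \<le> r" and i: "r \<le> i"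
  shows "w i = 0"
proof (rule ccontr)
  assume "w i \<noteq> 0"
  have "{s. s \<ge> 1 \<and> w (s - 1) \<noteq> 0} \<subseteq> Suc ` {i. w i \<noteq> 0}"
  proof
    fix s assume "s \<in> {s. s \<ge> 1 \<and> w (s - 1) \<noteq> 0}"
    then show "s \<in> Suc ` {i. w i \<noteq> 0}" by (intro image_eqI[of _ _ "s - 1"]) auto
  qed
  then have "finite {s. s \<ge> 1 \<and> w (s - 1) \<noteq> 0}"
    using w finite_subset by (auto simp: nonneg_decreasing_seq_def)
  \<comment> \<open>Position \<open>i\<close> holds the entry with mathematical index
    \<open>Suc i\<close>.\<close>
  then have "Suc i \<le> seq_length w"
    unfolding seq_length_def using \<open>w i \<noteq> 0\<close> by (intro Max_ge) auto
  then show False using r i by simp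
qed

theorem theorem2p1:
  fixes r :: nat and lam mu :: "nat \<Rightarrow> int" and C C' :: "(nat \<Rightarrow> int) \<Rightarrow> nat"
  assumes lam: "nonneg_decreasing_seq lam" and mu: "nonneg_decreasing_seq mu"
    and r_max: "r \<ge> max (seq_length lam) (seq_length mu)"
    and C: "tensor_decomposition r lam mu C"
    and C': "tensor_decomposition (r + 1) lam mu C'"
    and r_sum: "r \<ge> seq_length lam + seq_length mu"
  shows "\<forall>\<nu>. nonneg_decreasing_seq \<nu> \<and> seq_length \<nu> \<le> r \<longrightarrow> C \<nu> = C' \<nu>"
proof -
  obtain n \<rho> m \<sigma> \<nu>s d \<psi> where \<rho>: "is_Psi r lam n \<rho>" and \<sigma>: "is_Psi r mu m \<sigma>"
    and dom_all: "\<forall>\<nu>\<in>set \<nu>s. dominant_weight r \<nu>"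
    and \<psi>_all: "\<forall>\<nu>\<in>set \<nu>s. is_Psi r \<nu> (d \<nu>) (\<psi> \<nu>)"
    and char_all: "\<forall>g\<in>carrier (GL r).
      mat_trace (\<rho> g) * mat_trace (\<sigma> g) = (\<Sum>\<nu>\<in>set \<nu>s. of_nat (C \<nu>) * mat_trace (\<psi> \<nu> g))"
    and Cpos_all: "\<forall>\<nu>. C \<nu> > 0 \<longleftrightarrow> \<nu> \<in> set \<nu>s"
    by (rule tensor_decomposition_characters[OF C])
  obtain n' \<rho>' m' \<sigma>' \<nu>s' d' \<psi>' where \<rho>': "is_Psi (Suc r) lam n' \<rho>'" and \<sigma>': "is_Psi (Suc r) mu m' \<sigma>'"
    and dom'_all: "\<forall>\<nu>\<in>set \<nu>s'. dominant_weight (Suc r) \<nu>"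
    and \<psi>'_all: "\<forall>\<nu>\<in>set \<nu>s'. is_Psi (Suc r) \<nu> (d' \<nu>) (\<psi>' \<nu>)"
    and char'_all: "\<forall>g\<in>carrier (GL (Suc r)).
      mat_trace (\<rho>' g) * mat_trace (\<sigma>' g) = (\<Sum>\<nu>\<in>set \<nu>s'. of_nat (C' \<nu>) * mat_trace (\<psi>' \<nu> g))"
    and Cpos'_all: "\<forall>\<nu>. C' \<nu> > 0 \<longleftrightarrow> \<nu> \<in> set \<nu>s'"
    by (rule tensor_decomposition_characters[OF C'[unfolded Suc_eq_plus1[symmetric]]])
  note dom = bspec[OF dom_all] and \<psi> = bspec[OF \<psi>_all] and char = bspec[OF char_all]
    and Cpos = spec[OF Cpos_all] and dom' = bspec[OF dom'_all] and \<psi>' = bspec[OF \<psi>'_all]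
    and char' = bspec[OF char'_all] and Cpos' = spec[OF Cpos'_all]
  have "lam r = 0" "mu r = 0"
    using seq_length_le_imp_zero[OF lam] seq_length_le_imp_zero[OF mu] r_max by auto
  \<comment> \<open>For a vanishing last entry no normalisation by a power of \<open>t\<close> is
    needed. The truncation need not be the given model \<open>\<tau>\<close>, but both have the same
    character.\<close>
  have char_limit: "((\<lambda>t. mat_trace (\<tau>' (levi r g t))) \<longlongrightarrow> mat_trace (\<tau> g)) (at 0)"
    if \<tau>: "is_Psi r w k \<tau>" and \<tau>': "is_Psi (Suc r) w k' \<tau>'" and w: "w r = 0"
      and g: "g \<in> carrier (GL r)" for w k \<tau> k' \<tau>' g
  proof -
    obtain p \<upsilon> where "is_Psi r w p \<upsilon>"
      "((\<lambda>t. t powi (- w r) * mat_trace (\<tau>' (levi r g t))) \<longlongrightarrow> mat_trace (\<upsilon> g)) (at 0)"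
      using is_Psi_truncation[OF \<tau>'] g by metis
    then show ?thesis using is_Psi_trace_unique[OF \<tau> _ g] w by simp
  qed
  have lhs: "((\<lambda>t. mat_trace (\<rho>' (levi r g t)) * mat_trace (\<sigma>' (levi r g t))) \<longlongrightarrow>
      mat_trace (\<rho> g) * mat_trace (\<sigma> g)) (at 0)" if g: "g \<in> carrier (GL r)" for g
    by (intro tendsto_mult char_limit[OF \<rho> \<rho>' _ g] char_limit[OF \<sigma> \<sigma>' _ g]) fact+
  obtain p \<upsilon> where \<upsilon>_all: "\<forall>\<nu>\<in>set \<nu>s'. is_Psi r \<nu> (p \<nu>) (\<upsilon> \<nu>)"
    and lim_all: "\<forall>\<nu>\<in>set \<nu>s'. \<forall>g\<in>carrier (GL r).
      ((\<lambda>t. t powi (- \<nu> r) * mat_trace (\<psi>' \<nu> (levi r g t))) \<longlongrightarrow> mat_trace (\<upsilon> \<nu> g)) (at 0)"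
    by (rule is_Psi_truncation_family[OF \<psi>'])
  note \<upsilon> = bspec[OF \<upsilon>_all] and lim = bspec[OF bspec[OF lim_all]]
  have rhs: "((\<lambda>t. t powi (- k) * (mat_trace (\<rho>' (levi r g t)) * mat_trace (\<sigma>' (levi r g t)))) \<longlongrightarrow>
      (\<Sum>\<nu>\<in>{\<nu> \<in> set \<nu>s'. \<nu> r = k}. of_nat (C' \<nu>) * mat_trace (\<upsilon> \<nu> g))) (at 0)"
    if g: "g \<in> carrier (GL r)" and k: "\<forall>\<nu>\<in>set \<nu>s'. k \<le> \<nu> r" for g k
  proof -
    have lim_sum: "((\<lambda>t. \<Sum>\<nu>\<in>set \<nu>s'. of_nat (C' \<nu>) * (t powi (- k) * mat_trace (\<psi>' \<nu> (levi r g t)))) \<longlongrightarrow>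
        (\<Sum>\<nu>\<in>set \<nu>s'. of_nat (C' \<nu>) * (if \<nu> r = k then mat_trace (\<upsilon> \<nu> g) else 0))) (at 0)"
      by (intro tendsto_sum tendsto_mult tendsto_const tendsto_shifted_leading_term lim k[rule_format] g)
    have limit: "(\<Sum>\<nu>\<in>set \<nu>s'. of_nat (C' \<nu>) * (if \<nu> r = k then mat_trace (\<upsilon> \<nu> g) else 0)) =
        (\<Sum>\<nu>\<in>{\<nu> \<in> set \<nu>s'. \<nu> r = k}. of_nat (C' \<nu>) * mat_trace (\<upsilon> \<nu> g))"
      by (intro sum.mono_neutral_cong_right) auto
    have "\<forall>\<^sub>F t in at 0.
        (\<Sum>\<nu>\<in>set \<nu>s'. of_nat (C' \<nu>) * (t powi (- k) * mat_trace (\<psi>' \<nu> (levi r g t)))) =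
        t powi (- k) * (mat_trace (\<rho>' (levi r g t)) * mat_trace (\<sigma>' (levi r g t)))"
    proof (rule eventually_at_0I)
      fix t :: complex assume t: "t \<noteq> 0"
      show "(\<Sum>\<nu>\<in>set \<nu>s'. of_nat (C' \<nu>) * (t powi (- k) * mat_trace (\<psi>' \<nu> (levi r g t)))) =
          t powi (- k) * (mat_trace (\<rho>' (levi r g t)) * mat_trace (\<sigma>' (levi r g t)))"
        unfolding char'[OF levi_GL[OF g t]] by (simp add: sum_distrib_left mult.left_commute)
    qed
    from Lim_transform_eventually[OF lim_sum this] show ?thesis unfolding limit .
  qed
  have last_nonneg: "0 \<le> \<nu> r" if "\<nu> \<in> set \<nu>s'" for \<nu>
  proof (rule ccontr)
    assume neg: "\<not> 0 \<le> \<nu> r"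
    define k where "k = Min ((\<lambda>\<nu>. \<nu> r) ` set \<nu>s')"
    have k_le: "\<forall>\<mu>\<in>set \<nu>s'. k \<le> \<mu> r" by (simp add: k_def)
    then have "k < 0" using neg that by force
    have "k \<in> (\<lambda>\<nu>. \<nu> r) ` set \<nu>s'" unfolding k_def using that by (intro Min_in) auto
    then obtain \<kappa> where \<kappa>: "\<kappa> \<in> set \<nu>s'" "\<kappa> r = k" by auto
    \<comment> \<open>The product of characters has a finite limit by \<open>lhs\<close>, so with
      \<open>k < 0\<close> the normalised product tends to \<open>0\<close>.\<close>
    have "((\<lambda>t. t powi (- k) * (mat_trace (\<rho>' (levi r (1\<^sub>m r) t)) * mat_trace (\<sigma>' (levi r (1\<^sub>m r) t)))) \<longlongrightarrow>
        (if (0::int) = k then mat_trace (\<rho> (1\<^sub>m r)) * mat_trace (\<sigma> (1\<^sub>m r)) else 0)) (at 0)"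
      using lhs[OF one_GL] \<open>k < 0\<close> by (intro tendsto_shifted_leading_term) auto
    from tendsto_unique[OF at_neq_bot rhs[OF one_GL k_le] this] \<open>k < 0\<close>
    have "0 = (\<Sum>\<mu>\<in>{\<mu> \<in> set \<nu>s'. \<mu> r = k}. of_nat (C' \<mu>) * mat_trace (\<upsilon> \<mu> (1\<^sub>m r)))" by simp
    \<comment> \<open>At the identity the characters are dimensions, so the vanishing limit is a sum
      of natural numbers and every term is \<open>0\<close>.\<close>
    also have "\<dots> = (\<Sum>\<mu>\<in>{\<mu> \<in> set \<nu>s'. \<mu> r = k}. of_nat (C' \<mu> * p \<mu>))"
      using is_Psi_trace_one(1)[OF \<upsilon>] by (intro sum.cong) auto
    also have "\<dots> = of_nat (\<Sum>\<mu>\<in>{\<mu> \<in> set \<nu>s'. \<mu> r = k}. C' \<mu> * p \<mu>)" by simp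
    finally have "of_nat (\<Sum>\<mu>\<in>{\<mu> \<in> set \<nu>s'. \<mu> r = k}. C' \<mu> * p \<mu>) = (0 :: complex)"
      by (rule sym)
    then have "(\<Sum>\<mu>\<in>{\<mu> \<in> set \<nu>s'. \<mu> r = k}. C' \<mu> * p \<mu>) = 0"
      by (rule of_nat_eq_0_iff[THEN iffD1])
    moreover have "finite {\<mu> \<in> set \<nu>s'. \<mu> r = k}" by simp
    ultimately have "\<forall>\<mu>\<in>{\<mu> \<in> set \<nu>s'. \<mu> r = k}. C' \<mu> * p \<mu> = 0"
      by (simp only: sum_eq_0_iff)
    then have "C' \<kappa> * p \<kappa> = 0" by (rule bspec) (use \<kappa> in simp)
    then show False using \<kappa> Cpos'[of \<kappa>] is_Psi_trace_one(2)[OF \<upsilon>[OF \<kappa>(1)]] by simp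
  qed
  define N' where "N' = {\<nu> \<in> set \<nu>s'. \<nu> r = 0}"
  define N where "N = set \<nu>s \<union> N'"
  have char_trunc: "mat_trace (\<rho> g) * mat_trace (\<sigma> g) =
      (\<Sum>\<nu>\<in>N'. of_nat (C' \<nu>) * mat_trace (\<upsilon> \<nu> g))" if g: "g \<in> carrier (GL r)" for g
  proof -
    \<comment> \<open>\<open>rhs\<close> asks only for a lower bound of the last entries, so
      \<open>k = 0\<close> is allowed whether or not it is attained.\<close>
    have "((\<lambda>t. mat_trace (\<rho>' (levi r g t)) * mat_trace (\<sigma>' (levi r g t))) \<longlongrightarrow>
        (\<Sum>\<nu>\<in>N'. of_nat (C' \<nu>) * mat_trace (\<upsilon> \<nu> g))) (at 0)"
      using rhs[OF g, of 0] last_nonneg by (simp add: N'_def)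
    then show ?thesis by (rule tendsto_unique[OF at_neq_bot lhs[OF g]])
  qed
  \<comment> \<open>One model per weight is needed. On weights occurring in both ranks the two
    available models have equal characters by \<open>is_Psi_trace_unique\<close>.\<close>
  define \<phi> where "\<phi> \<nu> = (if \<nu> \<in> set \<nu>s then \<psi> \<nu> else \<upsilon> \<nu>)" for \<nu>
  define e where "e \<nu> = (if \<nu> \<in> set \<nu>s then d \<nu> else p \<nu>)" for \<nu>
  have \<phi>: "is_Psi r \<nu> (e \<nu>) (\<phi> \<nu>)" if "\<nu> \<in> N" for \<nu>
    using that \<psi> \<upsilon> by (auto simp: N_def N'_def \<phi>_def e_def)
  have finN: "finite N" by (simp add: N_def N'_def)
  \<comment> \<open>Weights in \<open>N\<close> are then determined by their first \<open>r\<close>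
    entries. For those from rank \<open>r + 1\<close>, dominance covers the positions beyond
    \<open>r\<close> and membership in \<open>N'\<close> the position \<open>r\<close>.\<close>
  have tail: "\<nu> i = 0" if "\<nu> \<in> N" "r \<le> i" for \<nu> i
  proof (cases "\<nu> \<in> set \<nu>s")
    case True
    then show ?thesis using dom[OF True] that by (simp add: dominant_weight_def)
  next
    case False
    then have "\<nu> \<in> set \<nu>s'" "\<nu> r = 0" using that by (auto simp: N_def N'_def)
    then show ?thesis using dom'[of \<nu>] that by (cases "i = r") (auto simp: dominant_weight_def)
  qed
  have diff: "(\<Sum>\<nu>\<in>N. (of_nat (C \<nu>) - of_nat (if \<nu> \<in> N' then C' \<nu> else 0)) * mat_trace (\<phi> \<nu> g)) = 0"
    if g: "g \<in> carrier (GL r)" for g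
  proof -
    have "(\<Sum>\<nu>\<in>N. of_nat (C \<nu>) * mat_trace (\<phi> \<nu> g)) = (\<Sum>\<nu>\<in>set \<nu>s. of_nat (C \<nu>) * mat_trace (\<psi> \<nu> g))"
    proof (rule sum.mono_neutral_cong_right[OF finN])
      show "\<forall>\<nu>\<in>N - set \<nu>s. of_nat (C \<nu>) * mat_trace (\<phi> \<nu> g) = 0"
        using Cpos by auto
    qed (auto simp: N_def \<phi>_def)
    moreover have "(\<Sum>\<nu>\<in>N. of_nat (if \<nu> \<in> N' then C' \<nu> else 0) * mat_trace (\<phi> \<nu> g)) =
        (\<Sum>\<nu>\<in>N'. of_nat (C' \<nu>) * mat_trace (\<upsilon> \<nu> g))"
    proof (rule sum.mono_neutral_cong_right[OF finN])
      fix \<nu> assume \<nu>: "\<nu> \<in> N'"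
      then have "mat_trace (\<phi> \<nu> g) = mat_trace (\<upsilon> \<nu> g)"
        using is_Psi_trace_unique[OF \<phi> \<upsilon> g] by (simp add: N_def N'_def)
      then show "of_nat (if \<nu> \<in> N' then C' \<nu> else 0) * mat_trace (\<phi> \<nu> g) =
          of_nat (C' \<nu>) * mat_trace (\<upsilon> \<nu> g)"
        using \<nu> by simp
    qed (auto simp: N_def)
    ultimately show ?thesis
      using char[OF g] char_trunc[OF g] by (simp add: left_diff_distrib sum_subtractf)
  qed
  have equal: "C \<nu> = (if \<nu> \<in> N' then C' \<nu> else 0)" if "\<nu> \<in> N" for \<nu>
  proof -
    have inj: "\<nu> = \<mu>" if "\<nu> \<in> N" "\<mu> \<in> N" "\<forall>i<r. \<nu> i = \<mu> i" for \<nu> \<mu>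
      using that tail by (intro ext) (metis not_less)
    have "(of_nat (C \<nu>) - of_nat (if \<nu> \<in> N' then C' \<nu> else 0) :: complex) = 0"
      by (rule characters_linearly_independent[OF finN \<phi> inj diff that])
    then have "(of_nat (C \<nu>) :: complex) = of_nat (if \<nu> \<in> N' then C' \<nu> else 0)"
      by (simp only: right_minus_eq)
    then show ?thesis by (rule of_nat_eq_iff[THEN iffD1])
  qed
  show ?thesis
  proof (intro allI impI)
    fix \<nu> :: "nat \<Rightarrow> int" assume "nonneg_decreasing_seq \<nu> \<and> seq_length \<nu> \<le> r"
    then have "\<nu> r = 0" using seq_length_le_imp_zero[of \<nu> r r] by simp
    \<comment> \<open>Outside \<open>N\<close> both multiplicities are therefore \<open>0\<close>;
      inside, \<open>equal\<close> applies.\<close>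
    then have N': "\<nu> \<in> N' \<longleftrightarrow> C' \<nu> > 0" using Cpos'[of \<nu>] by (simp add: N'_def)
    show "C \<nu> = C' \<nu>"
    proof (cases "\<nu> \<in> N")
      case True
      then show ?thesis using equal[OF True] N' by auto
    next
      case False
      then show ?thesis using N' Cpos[of \<nu>] by (auto simp: N_def)
    qed
  qed
qed

end
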